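(* For all integers $g\ge1$ and $n\geq2$, the image of the $\mathbb K$-algebra homomorphism $\pi_n^*:\mathbb K[\mathrm{Mat}_g^n]^{\mathbf{SL}_g}\to\mathbb K[V_g^{n+1}]^{\mathbf{SL}_g}$ has Krull dimension $(n-1)\frac{g(g+1)}{2}+g$.
   Context: $\mathbb K$ is an algebraically closed field. $V_g\subset\mathrm{Mat}_g$ is the space of symmetric $g\times g$ matrices. $\mathbf{SL}_g$ acts on $V_g^{n+1}$ diagonally by congruence $Q\mapsto\Lambda Q\Lambda^t$ and on $\mathrm{Mat}_g^n$ diagonally by conjugation $M\mapsto\Lambda M\Lambda^{-1}$; $\mathbb K[X]$ denotes the coordinate (polynomial) ring of the vector space $X$. For $M\in\mathrm{Mat}_g$, $M^*$ is its adjugate ($MM^*=\det(M)1_g$). The morphism $\pi_n:V_g^{n+1}\to\mathrm{Mat}_g^n$, $(Q_0,\dots,Q_n)\mapsto(Q_0Q_1^*,Q_1Q_2^*,\dots,Q_{n-1}Q_n^* )$, is $\mathbf{SL}_g$-equivariant and induces $\pi_n^*$ on rings of invariants. *)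

theory Defs
  imports
    "HOL-Library.Extended_Nat"
    "HOL-Library.FuncSet"
    "HOL-Computational_Algebra.Polynomial"
    "HOL-Algebra.Ideal"
    "HOL-Algebra.Generated_Rings"
    "Jordan_Normal_Form.Determinant"
    "Jordan_Normal_Form.Gauss_Jordan_Elimination"
begin

text \<open>Supremum of the lengths \<open>k\<close> of strict chains \<open>P 0 \<subset> \<dots> \<subset> P k\<close> of prime ideals. The zero ring,
  which has no prime ideals, gets the value \<open>0\<close>.\<close>

definition krull_dim :: "('a, 'b) ring_scheme \<Rightarrow> enat" where
  "krull_dim R = Sup {enat k | k. \<exists>P :: nat \<Rightarrow> 'a set.
     (\<forall>i\<le>k. primeideal (P i) R) \<and> (\<forall>i<k. P i \<subset> P (Suc i))}"

definition fun_ring :: "'a set \<Rightarrow> ('a \<Rightarrow> 'k::field) ring" where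
  "fun_ring X = \<lparr>carrier = X \<rightarrow>\<^sub>E UNIV,
     monoid.mult = (\<lambda>f h. \<lambda>x\<in>X. f x * h x), one = (\<lambda>x\<in>X. 1),
     zero = (\<lambda>x\<in>X. 0), add = (\<lambda>f h. \<lambda>x\<in>X. f x + h x)\<rparr>"

text \<open>The coordinate ring of a linear subspace \<open>X\<close> of the space of \<open>I\<close>-indexed tuples of
  \<open>g \<times> g\<close> matrices, as the ring of polynomial functions on \<open>X\<close>: over an infinite field this is the
  polynomial ring (the symmetric algebra of the dual of \<open>X\<close>). The matrix entries, restricted to
  \<open>X\<close>, span the dual of \<open>X\<close>.\<close>

definition coordinate_ring ::
  "nat \<Rightarrow> nat set \<Rightarrow> (nat \<Rightarrow> 'k mat) set \<Rightarrow> ((nat \<Rightarrow> 'k::field mat) \<Rightarrow> 'k) ring" where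
  "coordinate_ring g I X = (fun_ring X)\<lparr>carrier := generate_ring (fun_ring X)
     (range (\<lambda>c. \<lambda>x\<in>X. c) \<union> {\<lambda>x\<in>X. x k $$ (i, j) | k i j. k \<in> I \<and> i < g \<and> j < g})\<rparr>"

definition SL_mats :: "nat \<Rightarrow> 'k::field mat set" where
  "SL_mats g = {L \<in> carrier_mat g g. det L = 1}"

definition sym_mats :: "nat \<Rightarrow> 'k::field mat set" where
  "sym_mats g = {Q \<in> carrier_mat g g. transpose_mat Q = Q}"

definition sym_tuples :: "nat \<Rightarrow> nat \<Rightarrow> (nat \<Rightarrow> 'k::field mat) set" where
  "sym_tuples g n = {..n} \<rightarrow>\<^sub>E sym_mats g"

definition mat_tuples :: "nat \<Rightarrow> nat \<Rightarrow> (nat \<Rightarrow> 'k::field mat) set" where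
  "mat_tuples g n = {..<n} \<rightarrow>\<^sub>E carrier_mat g g"

definition congr_act :: "nat \<Rightarrow> 'k::field mat \<Rightarrow> (nat \<Rightarrow> 'k mat) \<Rightarrow> nat \<Rightarrow> 'k mat" where
  "congr_act n L Q = (\<lambda>k\<in>{..n}. L * Q k * transpose_mat L)"

definition conj_act :: "nat \<Rightarrow> 'k::field mat \<Rightarrow> (nat \<Rightarrow> 'k mat) \<Rightarrow> nat \<Rightarrow> 'k mat" where
  "conj_act n L M = (\<lambda>k\<in>{..<n}. L * M k * the (mat_inverse L))"

definition sym_invariants :: "nat \<Rightarrow> nat \<Rightarrow> ((nat \<Rightarrow> 'k::field mat) \<Rightarrow> 'k) ring" where
  "sym_invariants g n = (coordinate_ring g {..n} (sym_tuples g n))\<lparr>carrier :=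
     {f \<in> carrier (coordinate_ring g {..n} (sym_tuples g n)).
        \<forall>L\<in>SL_mats g. \<forall>Q\<in>sym_tuples g n. f (congr_act n L Q) = f Q}\<rparr>"

definition mat_invariants :: "nat \<Rightarrow> nat \<Rightarrow> ((nat \<Rightarrow> 'k::field mat) \<Rightarrow> 'k) ring" where
  "mat_invariants g n = (coordinate_ring g {..<n} (mat_tuples g n))\<lparr>carrier :=
     {f \<in> carrier (coordinate_ring g {..<n} (mat_tuples g n)).
        \<forall>L\<in>SL_mats g. \<forall>M\<in>mat_tuples g n. f (conj_act n L M) = f M}\<rparr>"

definition pi_map :: "nat \<Rightarrow> (nat \<Rightarrow> 'k::field mat) \<Rightarrow> nat \<Rightarrow> 'k mat" where
  "pi_map n Q = (\<lambda>k\<in>{..<n}. Q k * adj_mat (Q (Suc k)))"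

definition pi_star ::
  "nat \<Rightarrow> nat \<Rightarrow> ((nat \<Rightarrow> 'k::field mat) \<Rightarrow> 'k) \<Rightarrow> (nat \<Rightarrow> 'k mat) \<Rightarrow> 'k" where
  "pi_star g n f = (\<lambda>Q\<in>sym_tuples g n. f (pi_map n Q))"

end

theory Submission
  imports Defs "HOL-Library.Function_Algebras" "HOL-Library.Product_Lexorder" "Jordan_Normal_Form.Char_Poly"
begin

text \<open>Both bounds use the slice of those \<open>(Q\<^sub>0, \<dots>, Q\<^sub>n)\<close> for which \<open>Q\<^sub>n = 1\<close> and
  \<open>Q\<^sub>n\<^sub>-\<^sub>1\<close> is diagonal, an affine space of dimension \<open>(n - 1) g (g + 1) / 2 + g\<close>.

  Upper bound: if the eigenvalues of \<open>Q\<^sub>n\<^sub>-\<^sub>1 Q\<^sub>n\<^sup>*\<close> are distinct and all \<open>Q\<^sub>k\<close> are invertible, the pair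
  \<open>(Q\<^sub>n\<^sub>-\<^sub>1, Q\<^sub>n)\<close> is diagonalised by a congruence, and rescaling the \<open>Q\<^sub>k\<close> moves the tuple to the slice
  while \<open>\<pi>\<^sub>n\<close> changes by conjugation only. Hence the image restricts injectively to polynomials on the
  slice. A strict chain of \<open>k\<close> prime ideals in an algebra of functions yields \<open>k\<close> algebraically independent
  elements, and more polynomials than variables are dependent by counting monomials.

  Lower bound: fixing the coordinates of the slice one by one, first the diagonal of \<open>Q\<^sub>n\<^sub>-\<^sub>1\<close> to distinct
  nonzero values \<open>\<alpha>\<^sub>i\<close> and then \<open>Q\<^sub>0, Q\<^sub>1, \<dots>\<close> to zero, gives a chain of affine spaces, whose vanishing ideals
  are prime. Consecutive ones are separated by \<open>det (M\<^sub>n - \<alpha>\<^sub>i)\<close> and by \<open>tr (E\<^sub>i N E\<^sub>j N)\<close>, where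
  \<open>E\<^sub>i = \<Prod>\<^sub>j\<^sub>\<noteq>\<^sub>i (M\<^sub>n - \<alpha>\<^sub>j)\<close> is a multiple of a diagonal matrix unit and \<open>N = M\<^sub>k\<^sub>+\<^sub>1 \<cdots> M\<^sub>n\<close> is a scalar multiple
  of \<open>Q\<^sub>k\<close>.\<close>

text \<open>The dimension is that of the space of tuples, \<open>(n + 1) g (g + 1) / 2\<close>,
  minus \<open>g\<^sup>2\<close>: the group \<open>SL_g\<close> contributes
  \<open>g\<^sup>2 - 1\<close>, and the rescalings \<open>Q_k\<close> to \<open>s_k Q_k\<close> with
  \<open>s_k s_(k+1)^(g-1) = 1\<close>, which leave \<open>pi_map\<close> unchanged, contribute one
  more. The slice uses up these \<open>g\<^sup>2\<close> parameters on \<open>Q_n\<close> and on the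
  off-diagonal part of \<open>Q_(n-1)\<close>. Both bounds hold for arbitrary algebras of functions,
  so finite generation of the image never enters. Density and irreducibility are tested along lines,
  where a polynomial with infinitely many zeros is zero. The characteristic may be 2: distinct
  eigenvalues already make eigenvectors orthogonal, and only square roots are needed to normalise
  them. The order in the lower bound is forced. \<open>E_i\<close> is a multiple of a matrix unit
  only once the eigenvalues are fixed. The scalar in \<open>N\<close> is the product of the
  determinants of \<open>Q_(k+1), ..., Q_n\<close>, so \<open>Q_k\<close> has to be fixed while
  these are still free to be invertible.\<close>

lemma infinite_alg_closed_field: "infinite (UNIV :: 'k::alg_closed_field set)"
proof
  assume fin: "finite (UNIV :: 'k set)"
  define p where "p = (\<Prod>a\<in>(UNIV :: 'k set). [:- a, 1:]) + 1"
  have val: "poly p x = 1" for x :: 'k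
    using fin by (auto simp: p_def poly_prod prod_zero_iff)
  have deg: "degree (\<Prod>a\<in>(UNIV :: 'k set). [:- a, 1:]) = card (UNIV :: 'k set)"
    by (subst degree_prod_eq_sum_degree) auto
  have "card (UNIV :: 'k set) > 0" using fin by (simp add: finite_UNIV_card_ge_0)
  hence "degree p > 0" unfolding p_def by (subst degree_add_eq_left) (auto simp: deg)
  then obtain x where "poly p x = 0" using alg_closed_imp_poly_has_root by blast
  thus False using val by simp
qed

section \<open>Algebras of functions\<close>

text \<open>Functions live on the whole type and only their values on \<open>T\<close> count, which
  is the content of \<open>cong_closed\<close>; closure then applies to plain lambda terms.
  Instances are univariate polynomials, polynomials in the slice coordinates, coordinate rings,
  invariants and the image.\<close>

locale function_algebra =
  fixes T :: "'s set" and R :: "('s \<Rightarrow> 'k::field) set"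
  assumes const_closed: "\<And>c. (\<lambda>_. c) \<in> R"
    and add_closed: "\<And>F G. F \<in> R \<Longrightarrow> G \<in> R \<Longrightarrow> (\<lambda>s. F s + G s) \<in> R"
    and mult_closed: "\<And>F G. F \<in> R \<Longrightarrow> G \<in> R \<Longrightarrow> (\<lambda>s. F s * G s) \<in> R"
    and cong_closed: "\<And>F G. F \<in> R \<Longrightarrow> (\<And>s. s \<in> T \<Longrightarrow> G s = F s) \<Longrightarrow> G \<in> R"
begin

lemma cmult_closed: "F \<in> R \<Longrightarrow> (\<lambda>s. c * F s) \<in> R"
  by (rule mult_closed[OF const_closed])

lemma uminus_closed: "F \<in> R \<Longrightarrow> (\<lambda>s. - F s) \<in> R"
  using cmult_closed[of F "-1"] by simp

lemma diff_closed: "F \<in> R \<Longrightarrow> G \<in> R \<Longrightarrow> (\<lambda>s. F s - G s) \<in> R"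
  using add_closed[OF _ uminus_closed, of F G] by simp

lemma sum_closed: "(\<And>i. i \<in> I \<Longrightarrow> F i \<in> R) \<Longrightarrow> (\<lambda>s. \<Sum>i\<in>I. F i s) \<in> R"
  by (induction I rule: infinite_finite_induct) (auto intro: const_closed add_closed)

lemma prod_closed: "(\<And>i. i \<in> I \<Longrightarrow> F i \<in> R) \<Longrightarrow> (\<lambda>s. \<Prod>i\<in>I. F i s) \<in> R"
  by (induction I rule: infinite_finite_induct) (auto intro: const_closed mult_closed)

lemma power_closed: "F \<in> R \<Longrightarrow> (\<lambda>s. F s ^ m) \<in> R"
  by (induction m) (auto intro: const_closed mult_closed)

section \<open>Matrices with entries in a function algebra\<close>

definition matrix_function :: "nat \<Rightarrow> ('s \<Rightarrow> 'k mat) \<Rightarrow> bool" where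
  "matrix_function g W \<longleftrightarrow> (\<forall>s\<in>T. W s \<in> carrier_mat g g) \<and>
     (\<forall>i<g. \<forall>j<g. (\<lambda>s. W s $$ (i, j)) \<in> R)"

lemma matrix_functionI:
  "(\<And>s. s \<in> T \<Longrightarrow> W s \<in> carrier_mat g g) \<Longrightarrow>
   (\<And>i j. i < g \<Longrightarrow> j < g \<Longrightarrow> (\<lambda>s. W s $$ (i, j)) \<in> R) \<Longrightarrow> matrix_function g W"
  by (auto simp: matrix_function_def)

lemma matrix_functionD:
  "matrix_function g W \<Longrightarrow> s \<in> T \<Longrightarrow> W s \<in> carrier_mat g g"
  "matrix_function g W \<Longrightarrow> i < g \<Longrightarrow> j < g \<Longrightarrow> (\<lambda>s. W s $$ (i, j)) \<in> R"
  by (auto simp: matrix_function_def)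

lemma matrix_function_const: "A \<in> carrier_mat g g \<Longrightarrow> matrix_function g (\<lambda>_. A)"
  by (auto intro!: matrix_functionI const_closed)

lemma matrix_function_mult:
  assumes V: "matrix_function g V" and W: "matrix_function g W"
  shows "matrix_function g (\<lambda>s. V s * W s)"
proof (rule matrix_functionI)
  fix i j assume ij: "i < g" "j < g"
  have "(\<lambda>s. \<Sum>k\<in>{0..<g}. V s $$ (i, k) * W s $$ (k, j)) \<in> R"
    using ij by (intro sum_closed mult_closed matrix_functionD(2)[OF V] matrix_functionD(2)[OF W]) auto
  thus "(\<lambda>s. (V s * W s) $$ (i, j)) \<in> R"
  proof (rule cong_closed)
    fix s assume s: "s \<in> T"
    show "(V s * W s) $$ (i, j) = (\<Sum>k\<in>{0..<g}. V s $$ (i, k) * W s $$ (k, j))"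
      using matrix_functionD(1)[OF V s] matrix_functionD(1)[OF W s] ij
      by (auto simp: scalar_prod_def intro!: sum.cong)
  qed
next
  fix s assume s: "s \<in> T"
  show "V s * W s \<in> carrier_mat g g"
    using matrix_functionD(1)[OF V s] matrix_functionD(1)[OF W s] by simp
qed

lemma matrix_function_diff:
  assumes V: "matrix_function g V" and W: "matrix_function g W"
  shows "matrix_function g (\<lambda>s. V s - W s)"
proof (rule matrix_functionI)
  fix i j assume ij: "i < g" "j < g"
  have "(\<lambda>s. V s $$ (i, j) - W s $$ (i, j)) \<in> R"
    using ij by (intro diff_closed matrix_functionD(2)[OF V] matrix_functionD(2)[OF W]) auto
  thus "(\<lambda>s. (V s - W s) $$ (i, j)) \<in> R"
  proof (rule cong_closed)
    fix s assume s: "s \<in> T"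
    show "(V s - W s) $$ (i, j) = V s $$ (i, j) - W s $$ (i, j)"
      using matrix_functionD(1)[OF V s] matrix_functionD(1)[OF W s] ij by auto
  qed
next
  fix s assume s: "s \<in> T"
  show "V s - W s \<in> carrier_mat g g"
    using matrix_functionD(1)[OF V s] matrix_functionD(1)[OF W s] by auto
qed

lemma det_closed:
  assumes W: "matrix_function g W"
  shows "(\<lambda>s. det (W s)) \<in> R"
proof -
  have "(\<lambda>s. \<Sum>p\<in>{p. p permutes {0..<g}}. signof p * (\<Prod>i = 0..<g. W s $$ (i, p i))) \<in> R"
    by (intro sum_closed mult_closed const_closed prod_closed matrix_functionD(2)[OF W])
      (use permutes_in_image in fastforce)+
  thus ?thesis
  proof (rule cong_closed)
    fix s assume s: "s \<in> T"
    show "det (W s) = (\<Sum>p\<in>{p. p permutes {0..<g}}. signof p * (\<Prod>i = 0..<g. W s $$ (i, p i)))"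
      by (rule det_def'[OF matrix_functionD(1)[OF W s]])
  qed
qed

lemma trace_closed:
  assumes W: "matrix_function g W"
  shows "(\<lambda>s. \<Sum>i<g. W s $$ (i, i)) \<in> R"
  by (intro sum_closed matrix_functionD(2)[OF W]) auto

lemma matrix_function_adj:
  assumes W: "matrix_function g W"
  shows "matrix_function g (\<lambda>s. adj_mat (W s))"
proof (rule matrix_functionI)
  fix i j assume ij: "i < g" "j < g"
  have "matrix_function (g - 1) (\<lambda>s. mat_delete (W s) j i)"
  proof (rule matrix_functionI)
    fix s assume "s \<in> T"
    from matrix_functionD(1)[OF W this] show "mat_delete (W s) j i \<in> carrier_mat (g - 1) (g - 1)"
      by (auto simp: mat_delete_def)
  next
    fix i' j' assume ij': "i' < g - 1" "j' < g - 1"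
    let ?i = "if i' < j then i' else Suc i'" and ?j = "if j' < i then j' else Suc j'"
    have "(\<lambda>s. W s $$ (?i, ?j)) \<in> R"
      using ij' by (intro matrix_functionD(2)[OF W]) auto
    thus "(\<lambda>s. mat_delete (W s) j i $$ (i', j')) \<in> R"
    proof (rule cong_closed)
      fix s assume "s \<in> T"
      from matrix_functionD(1)[OF W this] ij'
      show "mat_delete (W s) j i $$ (i', j') = W s $$ (?i, ?j)" by (auto simp: mat_delete_def)
    qed
  qed
  hence "(\<lambda>s. (-1) ^ (j + i) * det (mat_delete (W s) j i)) \<in> R"
    by (intro cmult_closed det_closed)
  thus "(\<lambda>s. adj_mat (W s) $$ (i, j)) \<in> R"
  proof (rule cong_closed)
    fix s assume "s \<in> T"
    from matrix_functionD(1)[OF W this] ij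
    show "adj_mat (W s) $$ (i, j) = (-1) ^ (j + i) * det (mat_delete (W s) j i)"
      by (auto simp: adj_mat_def cofactor_def)
  qed
next
  fix s assume s: "s \<in> T"
  show "adj_mat (W s) \<in> carrier_mat g g"
    by (rule adj_mat(1)[OF matrix_functionD(1)[OF W s]])
qed

end

text \<open>The target algebra for restrictions to lines: a member that is not zero has finitely
  many roots.\<close>

interpretation univariate: function_algebra UNIV "range (\<lambda>p. poly p) :: ('k \<Rightarrow> 'k::field) set"
proof
  fix c :: 'k
  have "(\<lambda>_. c) = poly [:c:]" by auto
  thus "(\<lambda>_. c) \<in> range poly" by (metis rangeI)
next
  fix F G :: "'k \<Rightarrow> 'k" assume "F \<in> range poly" "G \<in> range poly"
  then obtain p q where pq: "F = poly p" "G = poly q" by auto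
  have "(\<lambda>s. F s + G s) = poly (p + q)" "(\<lambda>s. F s * G s) = poly (p * q)" by (auto simp: pq)
  thus "(\<lambda>s. F s + G s) \<in> range poly" "(\<lambda>s. F s * G s) \<in> range poly" by (metis rangeI)+
next
  fix F G :: "'k \<Rightarrow> 'k" assume "F \<in> range poly" "\<And>s. s \<in> UNIV \<Longrightarrow> G s = F s"
  thus "G \<in> range poly" by (metis UNIV_I ext)
qed

section \<open>Rings of functions\<close>

lemma fun_ring_simps:
  "carrier (fun_ring X) = X \<rightarrow>\<^sub>E UNIV"
  "f \<otimes>\<^bsub>fun_ring X\<^esub> h = (\<lambda>x\<in>X. f x * h x)" "f \<oplus>\<^bsub>fun_ring X\<^esub> h = (\<lambda>x\<in>X. f x + h x)"
  "\<one>\<^bsub>fun_ring X\<^esub> = (\<lambda>x\<in>X. 1)" "\<zero>\<^bsub>fun_ring X\<^esub> = (\<lambda>x\<in>X. 0)"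
  by (simp_all add: fun_ring_def)

lemma fun_ring_cring: "cring (fun_ring X :: ('a \<Rightarrow> 'k::field) ring)"
proof -
  have "\<exists>y\<in>X \<rightarrow>\<^sub>E UNIV. (\<lambda>z\<in>X. y z + x z) = (\<lambda>z\<in>X. 0)" for x :: "'a \<Rightarrow> 'k"
    by (rule bexI[of _ "\<lambda>z\<in>X. - x z"]) (auto simp: fun_eq_iff)
  thus ?thesis
    by (intro cringI abelian_groupI comm_monoidI)
      (auto simp: fun_ring_simps PiE_def extensional_def algebra_simps intro!: ext)
qed

lemma fun_ring_a_inv:
  assumes "f \<in> X \<rightarrow>\<^sub>E UNIV"
  shows "\<ominus>\<^bsub>fun_ring X\<^esub> f = (\<lambda>x\<in>X. - (f x :: 'k::field))"
proof -
  interpret cring "fun_ring X :: ('a \<Rightarrow> 'k) ring" by (rule fun_ring_cring)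
  show ?thesis
    by (rule minus_equality) (use assms in \<open>auto simp: fun_ring_simps fun_eq_iff\<close>)
qed

lemma coordinate_ring_extensional:
  assumes "f \<in> carrier (coordinate_ring g I X)"
  shows "f \<in> X \<rightarrow>\<^sub>E (UNIV :: 'k::field set)"
proof -
  interpret cring "fun_ring X :: ((nat \<Rightarrow> 'k mat) \<Rightarrow> 'k) ring" by (rule fun_ring_cring)
  let ?H = "range (\<lambda>c. \<lambda>x\<in>X. c) \<union> {\<lambda>x\<in>X. x k $$ (i, j) | k i j. k \<in> I \<and> i < g \<and> j < g} :: ((nat \<Rightarrow> 'k mat) \<Rightarrow> 'k) set"
  have H: "?H \<subseteq> carrier (fun_ring X)" by (auto simp: fun_ring_simps)
  have "f \<in> generate_ring (fun_ring X) ?H" using assms by (simp add: coordinate_ring_def)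
  from generate_ring_in_carrier[OF H this] show ?thesis by (simp add: fun_ring_simps)
qed

text \<open>Elements of the coordinate ring are polynomials in the matrix entries, so substituting a
  family \<open>\<gamma>\<close> lands in \<open>R\<close> as soon as its entries do. Restricting to
  lines and to the slice both rest on this induction.\<close>

lemma coordinate_ring_subst:
  fixes f :: "(nat \<Rightarrow> 'k::field mat) \<Rightarrow> 'k"
  assumes "f \<in> carrier (coordinate_ring g I X)"
    and alg: "function_algebra T R"
    and \<gamma>: "\<And>s. s \<in> T \<Longrightarrow> \<gamma> s \<in> X"
    and entries: "\<And>k i j. k \<in> I \<Longrightarrow> i < g \<Longrightarrow> j < g \<Longrightarrow> (\<lambda>s. \<gamma> s k $$ (i, j)) \<in> R"
  shows "(\<lambda>s. f (\<gamma> s)) \<in> R"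
proof -
  interpret function_algebra T R by fact
  interpret X: cring "fun_ring X :: ((nat \<Rightarrow> 'k mat) \<Rightarrow> 'k) ring" by (rule fun_ring_cring)
  let ?H = "range (\<lambda>c. \<lambda>x\<in>X. c) \<union> {\<lambda>x\<in>X. x k $$ (i, j) | k i j. k \<in> I \<and> i < g \<and> j < g} :: ((nat \<Rightarrow> 'k mat) \<Rightarrow> 'k) set"
  have H: "?H \<subseteq> carrier (fun_ring X)" by (auto simp: fun_ring_simps)
  have "f \<in> generate_ring (fun_ring X) ?H" using assms(1) by (simp add: coordinate_ring_def)
  thus ?thesis
  proof induction
    case one
    show ?case by (rule cong_closed[OF const_closed[of 1]]) (auto simp: fun_ring_simps \<gamma>)
  next
    case (incl h)
    then consider c where "h = (\<lambda>x\<in>X. c)"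
      | k i j where "h = (\<lambda>x\<in>X. x k $$ (i, j))" "k \<in> I" "i < g" "j < g" by blast
    thus ?case
    proof cases
      case (1 c)
      show ?thesis by (rule cong_closed[OF const_closed[of c]]) (auto simp: 1 \<gamma>)
    next
      case (2 k i j)
      show ?thesis by (rule cong_closed[OF entries[OF 2(2-)]]) (auto simp: 2(1) \<gamma>)
    qed
  next
    case (a_inv h)
    have "h \<in> X \<rightarrow>\<^sub>E UNIV" using X.generate_ring_in_carrier[OF H a_inv.hyps] by (simp add: fun_ring_simps)
    thus ?case by (intro cong_closed[OF uminus_closed[OF a_inv.IH]]) (auto simp: fun_ring_a_inv \<gamma>)
  next
    case (eng_add h1 h2)
    show ?case by (rule cong_closed[OF add_closed[OF eng_add.IH]]) (auto simp: fun_ring_simps \<gamma>)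
  next
    case (eng_mult h1 h2)
    show ?case by (rule cong_closed[OF mult_closed[OF eng_mult.IH]]) (auto simp: fun_ring_simps \<gamma>)
  qed
qed

text \<open>Members of the carrier are extensional, while \<open>function_algebra\<close> speaks of
  total functions; the preimage under restriction mediates between the two.\<close>

lemma coordinate_ring_function_algebra:
  "function_algebra X {F. restrict F X \<in> carrier (coordinate_ring g I X :: (_ \<Rightarrow> 'k::field) ring)}"
proof -
  let ?G = "generate_ring (fun_ring X) (range (\<lambda>c. \<lambda>x\<in>X. c) \<union>
      {\<lambda>x\<in>X. x k $$ (i, j) | k i j. k \<in> I \<and> i < g \<and> j < g}) :: ((nat \<Rightarrow> 'k mat) \<Rightarrow> 'k) set"
  have car: "carrier (coordinate_ring g I X) = ?G" by (simp add: coordinate_ring_def)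
  show ?thesis
  proof
    fix c show "(\<lambda>_. c) \<in> {F. restrict F X \<in> carrier (coordinate_ring g I X)}"
      unfolding car by (auto intro!: generate_ring.incl)
  next
    fix F G assume FG: "F \<in> {F. restrict F X \<in> carrier (coordinate_ring g I X)}"
      "G \<in> {F. restrict F X \<in> carrier (coordinate_ring g I X)}"
    have "restrict F X \<oplus>\<^bsub>fun_ring X\<^esub> restrict G X \<in> ?G"
      using FG unfolding car by (auto intro: generate_ring.eng_add)
    also have "restrict F X \<oplus>\<^bsub>fun_ring X\<^esub> restrict G X = (\<lambda>s\<in>X. F s + G s)"
      by (auto simp: fun_ring_simps fun_eq_iff)
    finally show "(\<lambda>s. F s + G s) \<in> {F. restrict F X \<in> carrier (coordinate_ring g I X)}"
      unfolding car mem_Collect_eq .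
    have "restrict F X \<otimes>\<^bsub>fun_ring X\<^esub> restrict G X \<in> ?G"
      using FG unfolding car by (auto intro: generate_ring.eng_mult)
    also have "restrict F X \<otimes>\<^bsub>fun_ring X\<^esub> restrict G X = (\<lambda>s\<in>X. F s * G s)"
      by (auto simp: fun_ring_simps fun_eq_iff)
    finally show "(\<lambda>s. F s * G s) \<in> {F. restrict F X \<in> carrier (coordinate_ring g I X)}"
      unfolding car mem_Collect_eq .
  next
    fix F G :: "(nat \<Rightarrow> 'k mat) \<Rightarrow> 'k"
    assume F: "F \<in> {F. restrict F X \<in> carrier (coordinate_ring g I X)}"
      and "\<And>s. s \<in> X \<Longrightarrow> G s = F s"
    hence "restrict G X = restrict F X" by (auto simp: fun_eq_iff)
    thus "G \<in> {F. restrict F X \<in> carrier (coordinate_ring g I X)}" using F by simp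
  qed
qed

lemma coordinate_ring_entry:
  "k \<in> I \<Longrightarrow> i < g \<Longrightarrow> j < g \<Longrightarrow>
   (\<lambda>x. x k $$ (i, j)) \<in> {F. restrict F X \<in> carrier (coordinate_ring g I X)}"
  unfolding coordinate_ring_def by (simp, rule generate_ring.incl, blast)

section \<open>Chains of prime ideals and algebraic independence\<close>

text \<open>Exponents form a list, and the recursion shifts the family \<open>x\<close>. Peeling off
  the first variable thus matches dropping the first prime of a chain in the induction
  below.\<close>

fun monomial :: "(nat \<Rightarrow> 's \<Rightarrow> 'k::field) \<Rightarrow> nat list \<Rightarrow> 's \<Rightarrow> 'k" where
  "monomial x [] s = 1"
| "monomial x (m # es) s = x 0 s ^ m * monomial (\<lambda>i. x (Suc i)) es s"

context function_algebra
begin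

lemma monomial_closed: "(\<And>i. i < length es \<Longrightarrow> x i \<in> R) \<Longrightarrow> monomial x es \<in> R"
proof (induction es arbitrary: x)
  case Nil
  show ?case by (rule cong_closed[OF const_closed[of 1]]) simp
next
  case (Cons m es)
  have "(\<lambda>s. x 0 s ^ m * monomial (\<lambda>i. x (Suc i)) es s) \<in> R"
    using Cons.prems[of 0] Cons.prems[of "Suc _"]
    by (intro mult_closed power_closed Cons.IH) auto
  thus ?case by (rule cong_closed) simp
qed

definition prime_in :: "('s \<Rightarrow> 'k) set \<Rightarrow> bool" where
  "prime_in P \<longleftrightarrow> P \<subseteq> R \<and> (\<lambda>_. 1) \<notin> P \<and> (\<forall>F\<in>P. \<forall>G\<in>P. (\<lambda>s. F s + G s) \<in> P) \<and>
     (\<forall>F\<in>R. \<forall>G\<in>P. (\<lambda>s. F s * G s) \<in> P) \<and>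
     (\<forall>F\<in>R. \<forall>G\<in>R. (\<lambda>s. F s * G s) \<in> P \<longrightarrow> F \<in> P \<or> G \<in> P)"

lemma prime_inD:
  assumes "prime_in P"
  shows "F \<in> P \<Longrightarrow> F \<in> R" "(\<lambda>_. 1) \<notin> P"
    "F \<in> P \<Longrightarrow> G \<in> P \<Longrightarrow> (\<lambda>s. F s + G s) \<in> P"
    "F \<in> R \<Longrightarrow> G \<in> P \<Longrightarrow> (\<lambda>s. F s * G s) \<in> P"
    "(\<lambda>s. F s * G s) \<in> P \<Longrightarrow> F \<in> R \<Longrightarrow> G \<in> R \<Longrightarrow> F \<in> P \<or> G \<in> P"
  using assms by (simp_all add: prime_in_def subset_iff)

lemma prime_in_power:
  assumes "prime_in P" "F \<in> R" "(\<lambda>s. F s ^ m) \<in> P"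
  shows "F \<in> P"
  using assms(3)
proof (induction m)
  case 0
  thus ?case using assms(1) by (simp add: prime_in_def)
next
  case (Suc m)
  have "(\<lambda>s. F s * F s ^ m) \<in> P" using Suc.prems by simp
  hence "F \<in> P \<or> (\<lambda>s. F s ^ m) \<in> P"
    by (rule prime_inD(5)[OF assms(1) _ assms(2) power_closed[OF assms(2)]])
  thus ?case using Suc.IH by blast
qed

text \<open>The lexicographically smallest monomial of a relation survives modulo the prime ideals.\<close>

lemma prime_chain_independent:
  assumes "\<And>i. i \<le> k \<Longrightarrow> prime_in (P i)"
    and "\<And>i. i < k \<Longrightarrow> P i \<subseteq> P (Suc i)"
    and "\<And>i. i < k \<Longrightarrow> x i \<in> P (Suc i) - P i"
    and "finite E" and "\<And>e. e \<in> E \<Longrightarrow> length e = k"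
    and "(\<lambda>s. \<Sum>e\<in>E. c e * monomial x e s) \<in> P 0"
    and "e \<in> E"
  shows "c e = 0"
  using assms
proof (induction k arbitrary: P x E c e)
  case 0
  have E: "E = {[]}" using "0.prems"(5,7) by auto
  have P0: "prime_in (P 0)" using "0.prems"(1) by simp
  show ?case
  proof (rule ccontr)
    assume "c e \<noteq> 0"
    hence c: "c [] \<noteq> 0" using "0.prems"(7) E by simp
    have "(\<lambda>_. c []) \<in> P 0" using "0.prems"(6) by (simp add: E)
    from prime_inD(4)[OF P0 const_closed this] have "(\<lambda>s. inverse (c []) * c []) \<in> P 0" .
    thus False using c prime_inD(2)[OF P0] by simp
  qed
next
  case (Suc k)
  note P = Suc.prems(1) and chain = Suc.prems(2) and x = Suc.prems(3)
  have P0: "prime_in (P 0)" and P1: "prime_in (P 1)" using P by auto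
  have xR: "x i \<in> R" if "i < Suc k" for i
    using x[OF that] P[of "Suc i"] that by (auto dest: prime_inD(1))
  let ?x' = "\<lambda>i. x (Suc i)"
  show ?case
  proof (rule ccontr)
    assume "c e \<noteq> 0"
    define E' where "E' = {e \<in> E. c e \<noteq> 0}"
    have finE': "finite E'" using Suc.prems(4) by (simp add: E'_def)
    have lenE': "length e = Suc k" if "e \<in> E'" for e
      using Suc.prems(5) that by (simp add: E'_def)
    have eE': "e \<in> E'" using \<open>c e \<noteq> 0\<close> Suc.prems(7) by (simp add: E'_def)
    \<comment> \<open>Least exponent of \<open>x 0\<close> among the terms with nonzero coefficient.
      Since \<open>x 0\<close> lies outside the prime ideal \<open>P 0\<close>, the factor
      \<open>x 0 ^ m\<close> can be cancelled from the relation modulo \<open>P 0\<close>.\<close>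
    define m where "m = Min (hd ` E')"
    have m_le: "m \<le> hd e" if "e \<in> E'" for e using finE' that by (simp add: m_def)
    have "m \<in> hd ` E'" unfolding m_def using finE' eE' by (intro Min_in) auto
    then obtain e0 where e0: "e0 \<in> E'" "hd e0 = m" by auto
    define E1 where "E1 = {e \<in> E'. hd e = m}"
    have decomp: "monomial x e s = x 0 s ^ m * (x 0 s ^ (hd e - m) * monomial ?x' (tl e) s)"
      if "e \<in> E'" for e s
    proof -
      from lenE'[OF that] obtain a es where "e = a # es" by (cases e) auto
      thus ?thesis using m_le[OF that] by (simp flip: power_add mult.assoc)
    qed
    have monR: "monomial ?x' (tl e) \<in> R" if "e \<in> E'" for e
      using lenE'[OF that] by (intro monomial_closed xR) auto
    define G where "G = (\<lambda>s. \<Sum>e\<in>E'. c e * (x 0 s ^ (hd e - m) * monomial ?x' (tl e) s))"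
    have GR: "G \<in> R" unfolding G_def
      by (intro sum_closed cmult_closed mult_closed power_closed xR monR) auto
    have "(\<lambda>s. \<Sum>e\<in>E. c e * monomial x e s) = (\<lambda>s. x 0 s ^ m * G s)"
    proof
      fix s
      have "(\<Sum>e\<in>E. c e * monomial x e s) = (\<Sum>e\<in>E'. c e * monomial x e s)"
        using Suc.prems(4) by (intro sum.mono_neutral_right) (auto simp: E'_def)
      also have "\<dots> = x 0 s ^ m * G s"
        unfolding G_def sum_distrib_left by (rule sum.cong) (auto simp: decomp)
      finally show "(\<Sum>e\<in>E. c e * monomial x e s) = x 0 s ^ m * G s" .
    qed
    hence "(\<lambda>s. x 0 s ^ m * G s) \<in> P 0" using Suc.prems(6) by simp
    hence "(\<lambda>s. x 0 s ^ m) \<in> P 0 \<or> G \<in> P 0"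
      by (rule prime_inD(5)[OF P0 _ power_closed[OF xR] GR]) simp
    moreover have "(\<lambda>s. x 0 s ^ m) \<notin> P 0"
      using prime_in_power[OF P0 xR[of 0], of m] x[of 0] by auto
    ultimately have GP1: "G \<in> P 1" using chain[of 0] by auto
    \<comment> \<open>The terms of \<open>G\<close> still divisible by \<open>x 0\<close>, with one
      factor removed. As \<open>x 0\<close> lies in \<open>P 1\<close>, they vanish modulo
      \<open>P 1\<close>; what remains of \<open>G\<close> is a relation between the later
      \<open>x i\<close> for the shifted chain.\<close>
    define H where "H = (\<lambda>s. \<Sum>e\<in>E' - E1. c e * (x 0 s ^ (hd e - m - 1) * monomial ?x' (tl e) s))"
    have HR: "H \<in> R" unfolding H_def
      by (intro sum_closed cmult_closed mult_closed power_closed xR monR) auto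
    have "(\<lambda>s. - H s * x 0 s) \<in> P 1"
      using x[of 0] by (intro prime_inD(4)[OF P1 uminus_closed[OF HR]]) auto
    from prime_inD(3)[OF P1 GP1 this] have "(\<lambda>s. G s + - H s * x 0 s) \<in> P 1" .
    also have "(\<lambda>s. G s + - H s * x 0 s) = (\<lambda>s. \<Sum>e\<in>tl ` E1. c (m # e) * monomial ?x' e s)"
    proof
      fix s
      have "H s * x 0 s = (\<Sum>e\<in>E' - E1. c e * (x 0 s ^ (hd e - m) * monomial ?x' (tl e) s))"
        unfolding H_def sum_distrib_right
      proof (rule sum.cong)
        fix e assume e: "e \<in> E' - E1"
        hence "hd e > m" using m_le[of e] by (auto simp: E1_def)
        hence "hd e - m = Suc (hd e - m - 1)" by simp
        hence "x 0 s ^ (hd e - m) = x 0 s * x 0 s ^ (hd e - m - 1)" by (metis power_Suc)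
        thus "c e * (x 0 s ^ (hd e - m - 1) * monomial ?x' (tl e) s) * x 0 s =
            c e * (x 0 s ^ (hd e - m) * monomial ?x' (tl e) s)" by simp
      qed simp
      moreover have "G s = (\<Sum>e\<in>E' - E1. c e * (x 0 s ^ (hd e - m) * monomial ?x' (tl e) s)) +
          (\<Sum>e\<in>E1. c e * (x 0 s ^ (hd e - m) * monomial ?x' (tl e) s))"
        unfolding G_def using finE' by (intro sum.subset_diff) (auto simp: E1_def)
      moreover have "(\<Sum>e\<in>E1. c e * (x 0 s ^ (hd e - m) * monomial ?x' (tl e) s)) =
          (\<Sum>e\<in>tl ` E1. c (m # e) * monomial ?x' e s)"
      proof (subst sum.reindex)
        show "inj_on tl E1"
        proof
          fix a b assume ab: "a \<in> E1" "b \<in> E1" "tl a = tl b"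
          hence "a \<noteq> []" "b \<noteq> []" "hd a = hd b" using lenE'[of a] lenE'[of b] by (auto simp: E1_def)
          thus "a = b" using ab(3) by (metis list.collapse)
        qed
        have "m # tl a = a" if "a \<in> E1" for a
          using that lenE'[of a] by (cases a) (auto simp: E1_def)
        thus "(\<Sum>e\<in>E1. c e * (x 0 s ^ (hd e - m) * monomial ?x' (tl e) s)) =
          sum ((\<lambda>e. c (m # e) * monomial ?x' e s) \<circ> tl) E1"
          by (intro sum.cong) (auto simp: E1_def)
      qed
      ultimately show "G s + - H s * x 0 s = (\<Sum>e\<in>tl ` E1. c (m # e) * monomial ?x' e s)" by simp
    qed
    finally have in1: "(\<lambda>s. \<Sum>e\<in>tl ` E1. c (m # e) * monomial ?x' e s) \<in> P (Suc 0)" by simp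
    have "c (m # tl e0) = 0"
    proof (rule Suc.IH[of "\<lambda>i. P (Suc i)" ?x' "tl ` E1" "\<lambda>e. c (m # e)"])
      show "length e = k" if "e \<in> tl ` E1" for e using that lenE' by (auto simp: E1_def)
    qed (use in1 e0 finE' P chain x in \<open>auto simp: E1_def\<close>)
    moreover have "m # tl e0 = e0" using e0 lenE'[of e0] by (cases e0) auto
    ultimately show False using e0(1) by (simp add: E'_def)
  qed
qed

end

section \<open>Polynomial functions in finitely many variables\<close>

interpretation fun_space: vector_space "\<lambda>c (f :: 's \<Rightarrow> 'k::field) s. c * f s"
  by unfold_locales (auto simp: fun_eq_iff algebra_simps)

lemma sum_fun_apply: "(\<Sum>i\<in>I. f i) s = (\<Sum>i\<in>I. (f i s :: 'k::comm_monoid_add))"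
  by (induction I rule: infinite_finite_induct) auto

definition box_monomial :: "'j set \<Rightarrow> ('j \<Rightarrow> nat) \<Rightarrow> ('j \<Rightarrow> 'k::field) \<Rightarrow> 'k" where
  "box_monomial J e \<tau> = (\<Prod>j\<in>J. \<tau> j ^ e j)"

text \<open>Each exponent is bounded separately, not the total degree: this leaves at most
  \<open>(D + 1) ^ card J\<close> monomials to count, and bounds still add under
  multiplication.\<close>

definition box_polys :: "'j set \<Rightarrow> nat \<Rightarrow> (('j \<Rightarrow> 'k::field) \<Rightarrow> 'k) set" where
  "box_polys J D = fun_space.span (box_monomial J ` (J \<rightarrow>\<^sub>E {..D}))"

lemma box_monomial_in:
  assumes "\<And>j. j \<in> J \<Longrightarrow> e j \<le> D"
  shows "box_monomial J e \<in> box_polys J D"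
proof -
  have "box_monomial J e = box_monomial J (restrict e J)"
    by (auto simp: box_monomial_def fun_eq_iff intro!: prod.cong)
  moreover have "restrict e J \<in> J \<rightarrow>\<^sub>E {..D}" using assms by auto
  ultimately show ?thesis unfolding box_polys_def by (metis fun_space.span_base imageI)
qed

lemma box_polys_mono: "D \<le> D' \<Longrightarrow> box_polys J D \<subseteq> box_polys J D'"
  unfolding box_polys_def by (intro fun_space.span_mono image_mono PiE_mono) auto

lemma box_polys_add: "F \<in> box_polys J D \<Longrightarrow> G \<in> box_polys J D \<Longrightarrow> (\<lambda>s. F s + G s) \<in> box_polys J D"
  using fun_space.span_add[of F _ G] by (simp add: box_polys_def plus_fun_def)

lemma box_polys_const: "(\<lambda>_. c) \<in> box_polys J D"
  using fun_space.span_scale[of "box_monomial J (\<lambda>_. 0)" _ c] box_monomial_in[of J "\<lambda>_. 0" D]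
  by (simp add: box_polys_def box_monomial_def)

lemma box_polys_mult:
  assumes F: "F \<in> box_polys J D" and G: "G \<in> box_polys J D'"
  shows "(\<lambda>s. F s * G s) \<in> box_polys J (D + D')"
proof -
  have mono: "(\<lambda>s. box_monomial J e s * G s) \<in> box_polys J (D + D')" if e: "e \<in> J \<rightarrow>\<^sub>E {..D}" for e
    using G unfolding box_polys_def[of J D']
  proof (induction rule: fun_space.span_induct_alt)
    case base
    thus ?case using box_polys_const[of 0] by simp
  next
    case (step c x y)
    then obtain e' where e': "x = box_monomial J e'" "e' \<in> J \<rightarrow>\<^sub>E {..D'}" by auto
    have "(\<lambda>s. box_monomial J e s * x s) = box_monomial J (\<lambda>j. e j + e' j)"
      by (auto simp: e' box_monomial_def power_add prod.distrib)
    also have "\<dots> \<in> box_polys J (D + D')"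
      using e e'(2) by (intro box_monomial_in add_mono) auto
    finally have "(\<lambda>s. c * (box_monomial J e s * x s)) \<in> box_polys J (D + D')"
      unfolding box_polys_def by (rule fun_space.span_scale)
    from box_polys_add[OF this step(2)] show ?case by (simp add: algebra_simps)
  qed
  show ?thesis using F unfolding box_polys_def[of J D]
  proof (induction rule: fun_space.span_induct_alt)
    case base
    thus ?case using box_polys_const[of 0] by simp
  next
    case (step c x y)
    then obtain e where e: "x = box_monomial J e" "e \<in> J \<rightarrow>\<^sub>E {..D}" by auto
    have "(\<lambda>s. c * (x s * G s)) \<in> box_polys J (D + D')"
      using mono[OF e(2)] unfolding box_polys_def e(1) by (rule fun_space.span_scale)
    from box_polys_add[OF this step(2)] show ?case by (simp add: algebra_simps)
  qed
qed

lemma box_polys_function_algebra: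
  "function_algebra UNIV (\<Union>D. box_polys (J :: 'j set) D :: (('j \<Rightarrow> 'k::field) \<Rightarrow> 'k) set)"
proof
  fix F G :: "('j \<Rightarrow> 'k) \<Rightarrow> 'k" assume "F \<in> (\<Union>D. box_polys J D)" "G \<in> (\<Union>D. box_polys J D)"
  then obtain D D' where F: "F \<in> box_polys J D" and G: "G \<in> box_polys J D'" by auto
  hence "F \<in> box_polys J (D + D')" "G \<in> box_polys J (D + D')"
    using box_polys_mono[of D "D + D'" J] box_polys_mono[of D' "D + D'" J] by auto
  thus "(\<lambda>s. F s + G s) \<in> (\<Union>D. box_polys J D)" using box_polys_add by blast
  show "(\<lambda>s. F s * G s) \<in> (\<Union>D. box_polys J D)" using box_polys_mult[OF F G] by blast
next
  fix F G :: "('j \<Rightarrow> 'k) \<Rightarrow> 'k" assume "F \<in> (\<Union>D. box_polys J D)" "\<And>s. s \<in> UNIV \<Longrightarrow> G s = F s"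
  moreover from this(2) have "G = F" by auto
  ultimately show "G \<in> (\<Union>D. box_polys J D)" by simp
qed (use box_polys_const in blast)

lemma box_polys_coordinate:
  fixes J :: "'j set"
  assumes "finite J" "j \<in> J"
  shows "(\<lambda>\<tau> :: 'j \<Rightarrow> 'k::field. \<tau> j) \<in> box_polys J 1"
proof -
  have "(\<lambda>\<tau> :: 'j \<Rightarrow> 'k. \<tau> j) = box_monomial J (\<lambda>i. if i = j then 1 else 0)"
  proof
    fix \<tau> :: "'j \<Rightarrow> 'k"
    have "box_monomial J (\<lambda>i. if i = j then 1 else 0) \<tau> = (\<Prod>i\<in>J. if i = j then \<tau> i else 1)"
      unfolding box_monomial_def by (intro prod.cong) auto
    thus "\<tau> j = box_monomial J (\<lambda>i. if i = j then 1 else 0) \<tau>" using assms by simp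
  qed
  also have "\<dots> \<in> box_polys J 1" by (rule box_monomial_in) simp
  finally show ?thesis .
qed

lemma box_polys_power: "F \<in> box_polys J D \<Longrightarrow> (\<lambda>s. F s ^ m) \<in> box_polys J (m * D)"
proof (induction m)
  case 0
  thus ?case using box_polys_const[of 1] by simp
next
  case (Suc m)
  from box_polys_mult[OF Suc.prems Suc.IH[OF Suc.prems]] show ?case by simp
qed

lemma box_polys_monomial:
  "(\<And>i. i < length es \<Longrightarrow> x i \<in> box_polys J D) \<Longrightarrow> monomial x es \<in> box_polys J (sum_list es * D)"
proof (induction es arbitrary: x)
  case Nil
  have "monomial x [] = (\<lambda>_. 1)" by auto
  thus ?case using box_polys_const[of 1] by simp
next
  case (Cons m es)
  have "(\<lambda>s. x 0 s ^ m * monomial (\<lambda>i. x (Suc i)) es s) \<in> box_polys J (m * D + sum_list es * D)"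
    using Cons.prems[of 0] Cons.prems[of "Suc _"]
    by (intro box_polys_mult box_polys_power Cons.IH) auto
  moreover have "monomial x (m # es) = (\<lambda>s. x 0 s ^ m * monomial (\<lambda>i. x (Suc i)) es s)" by auto
  ultimately show ?case by (simp add: algebra_simps)
qed

text \<open>The \<open>k\<close> polynomials have \<open>(m + 1) ^ k\<close> monomials with
  exponents up to \<open>m\<close>, all in a space whose dimension grows only like
  \<open>m ^ card J\<close>. For large \<open>m\<close> there are too many of them to be
  independent.\<close>

lemma polynomials_dependent:
  fixes x :: "nat \<Rightarrow> ('j \<Rightarrow> 'k::field) \<Rightarrow> 'k"
  assumes J: "finite J" "card J < k" and x: "\<And>i. i < k \<Longrightarrow> x i \<in> (\<Union>D. box_polys J D)"
  obtains E c e where "finite E" "\<And>e. e \<in> E \<Longrightarrow> length e = k" "e \<in> E" "c e \<noteq> 0"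
    "\<And>\<tau>. (\<Sum>e\<in>E. c e * monomial x e \<tau>) = 0"
proof -
  from x have "\<forall>i. \<exists>D. i < k \<longrightarrow> x i \<in> box_polys J D" by blast
  then obtain Di where Di: "\<And>i. i < k \<Longrightarrow> x i \<in> box_polys J (Di i)" by metis
  define D where "D = (\<Sum>i<k. Di i)"
  have xD: "x i \<in> box_polys J D" if "i < k" for i
  proof -
    have "Di i \<le> D" unfolding D_def using that by (intro member_le_sum) auto
    thus ?thesis using Di[OF that] box_polys_mono by blast
  qed
  \<comment> \<open>Chosen so that \<open>((D * k + 1) * (m + 1)) ^ card J\<close> equals
    \<open>m * (m + 1) ^ card J\<close>, which is just below
    \<open>(m + 1) ^ Suc (card J)\<close>.\<close>
  define m where "m = (D * k + 1) ^ card J"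
  define E where "E = {es. set es \<subseteq> {..m} \<and> length es = k}"
  have finE: "finite E" unfolding E_def by (intro finite_lists_length_eq) auto
  have cardE: "card E = (m + 1) ^ k" unfolding E_def by (subst card_lists_length_eq) auto
  let ?B = "box_monomial J ` (J \<rightarrow>\<^sub>E {..k * m * D}) :: (('j \<Rightarrow> 'k) \<Rightarrow> 'k) set"
  have finB: "finite ?B" using J(1) by (intro finite_imageI finite_PiE) auto
  have "card ?B \<le> card (J \<rightarrow>\<^sub>E {..k * m * D})"
    using J(1) by (intro card_image_le finite_PiE) auto
  also have "\<dots> = (k * m * D + 1) ^ card J" using J(1) by (simp add: card_PiE)
  also have "\<dots> \<le> ((D * k + 1) * (m + 1)) ^ card J"
    by (intro power_mono) (auto simp: algebra_simps)
  also have "\<dots> = m * (m + 1) ^ card J" by (simp only: m_def power_mult_distrib)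
  also have "\<dots> < (m + 1) ^ Suc (card J)" by simp
  also have "\<dots> \<le> (m + 1) ^ k" using J(2) by (intro power_increasing) auto
  finally have cardB: "card ?B < card E" by (simp add: cardE)
  have span: "monomial x e \<in> fun_space.span ?B" if e: "e \<in> E" for e
  proof -
    have "sum_list e \<le> k * m"
      using e sum_list_mono[of e "\<lambda>a. a" "\<lambda>_. m"] by (auto simp: E_def sum_list_triv)
    hence "sum_list e * D \<le> k * m * D" by simp
    moreover have "monomial x e \<in> box_polys J (sum_list e * D)"
      using e by (intro box_polys_monomial xD) (auto simp: E_def)
    ultimately show ?thesis using box_polys_mono unfolding box_polys_def by blast
  qed
  show ?thesis
  \<comment> \<open>Linear dependence concerns a set of functions, in which coinciding monomials
    merge. Two exponent lists with the same function already give a relation, with coefficients 1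
    and -1.\<close>
  proof (cases "inj_on (monomial x) E")
    case False
    then obtain e e' where ee: "e \<in> E" "e' \<in> E" "e \<noteq> e'" "monomial x e = monomial x e'"
      by (auto simp: inj_on_def)
    show ?thesis
    proof (rule that[of "{e, e'}" e "\<lambda>a. if a = e then 1 else -1"])
      show "\<And>\<tau>. (\<Sum>a\<in>{e, e'}. (if a = e then 1 else -1) * monomial x a \<tau>) = 0"
        using ee(3,4) by auto
    qed (use ee in \<open>auto simp: E_def\<close>)
  next
    case True
    have "fun_space.dependent (monomial x ` E)"
    proof (rule ccontr)
      assume "\<not> fun_space.dependent (monomial x ` E)"
      from fun_space.independent_span_bound[OF finB this] span
      have "card (monomial x ` E) \<le> card ?B" by blast
      thus False using cardB card_image[OF True] by simp
    qed
    then obtain u v where uv: "v \<in> monomial x ` E" "u v \<noteq> 0"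
      "(\<Sum>v\<in>monomial x ` E. (\<lambda>s. u v * v s)) = 0"
      using fun_space.dependent_finite[of "monomial x ` E"] finE by blast
    from uv(1) obtain e where e: "e \<in> E" "v = monomial x e" by blast
    show ?thesis
    proof (rule that[of E e "\<lambda>a. u (monomial x a)"])
      fix \<tau>
      have "(\<Sum>v\<in>monomial x ` E. u v * v \<tau>) = 0"
        using fun_cong[OF uv(3), of \<tau>] by (simp add: sum_fun_apply)
      thus "(\<Sum>a\<in>E. u (monomial x a) * monomial x a \<tau>) = 0"
        by (subst (asm) sum.reindex[OF True]) simp
    qed (use e uv finE in \<open>auto simp: E_def\<close>)
  qed
qed

section \<open>Normal forms of pairs of symmetric matrices\<close>

lemma adj_mat_unique:
  fixes B :: "'k::field mat"
  assumes B: "B \<in> carrier_mat g g" and X: "X \<in> carrier_mat g g"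
    and det: "det B \<noteq> 0" and BX: "B * X = det B \<cdot>\<^sub>m 1\<^sub>m g"
  shows "adj_mat B = X"
proof -
  have "det B \<cdot>\<^sub>m adj_mat B = adj_mat B * (det B \<cdot>\<^sub>m 1\<^sub>m g)"
    using adj_mat(1)[OF B] by (simp add: mult_smult_distrib[of _ g g _ g])
  also have "\<dots> = adj_mat B * B * X"
    unfolding BX[symmetric] using adj_mat(1)[OF B] B X by (simp add: assoc_mult_mat[of _ g g _ g _ g])
  also have "\<dots> = det B \<cdot>\<^sub>m X"
    unfolding adj_mat(3)[OF B] using X by (simp add: mult_smult_assoc_mat[of _ g g _ g])
  finally have eq: "det B \<cdot>\<^sub>m adj_mat B = det B \<cdot>\<^sub>m X" .
  have "det B * adj_mat B $$ (i, j) = det B * X $$ (i, j)" if "i < g" "j < g" for i j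
    using arg_cong[OF eq, of "\<lambda>M. M $$ (i, j)"] that adj_mat(1)[OF B] X by simp
  thus ?thesis using det adj_mat(1)[OF B] X by (intro eq_matI) auto
qed

lemma adj_mat_one: "adj_mat (1\<^sub>m g :: 'k::field mat) = 1\<^sub>m g"
  by (rule adj_mat_unique[of _ g]) auto

lemma inverse_matE:
  fixes P :: "'k::field mat"
  assumes P: "P \<in> carrier_mat g g" and det: "det P \<noteq> 0"
  obtains P' where "P' \<in> carrier_mat g g" "P * P' = 1\<^sub>m g" "P' * P = 1\<^sub>m g"
proof (rule that[of "(1 / det P) \<cdot>\<^sub>m adj_mat P"])
  show "(1 / det P) \<cdot>\<^sub>m adj_mat P \<in> carrier_mat g g" using adj_mat(1)[OF P] by simp
  show "P * ((1 / det P) \<cdot>\<^sub>m adj_mat P) = 1\<^sub>m g"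
    using adj_mat[OF P] P det by (auto simp: mult_smult_distrib[of _ g g _ g] intro!: eq_matI)
  show "((1 / det P) \<cdot>\<^sub>m adj_mat P) * P = 1\<^sub>m g"
    using adj_mat[OF P] P det by (auto simp: mult_smult_assoc_mat[of _ g g _ g] intro!: eq_matI)
qed

lemma mat_inverse_eq:
  fixes L :: "'k::field mat"
  assumes L: "L \<in> carrier_mat g g" and B: "B \<in> carrier_mat g g" and LB: "L * B = 1\<^sub>m g"
  shows "mat_inverse L = Some B"
proof (cases "mat_inverse L")
  case None
  have BL: "B * L = 1\<^sub>m g" by (rule mat_mult_left_right_inverse[OF L B LB])
  have "L \<in> Units (ring_mat TYPE('k) g ())"
    using L B LB BL by (auto simp: Units_def ring_mat_simps)
  with mat_inverse(1)[OF L None, of "()"] show ?thesis by blast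
next
  case (Some C)
  from mat_inverse(2)[OF L Some] have C: "L * C = 1\<^sub>m g" "C * L = 1\<^sub>m g" "C \<in> carrier_mat g g" by auto
  have "C = C * (L * B)" using C LB by simp
  also have "\<dots> = (C * L) * B" by (rule assoc_mult_mat[symmetric, OF C(3) L B])
  also have "\<dots> = B" unfolding C(2) using B by simp
  finally show ?thesis using Some by simp
qed

lemma mat_diag_index: "i < g \<Longrightarrow> j < g \<Longrightarrow> mat_diag g f $$ (i, j) = (if i = j then f i else 0)"
  by (simp add: mat_diag_def)

lemma mat_diag_transpose: "transpose_mat (mat_diag g f) = mat_diag g f"
  by (rule eq_matI) (auto simp: mat_diag_def)

lemma det_mat_diag: "det (mat_diag g f) = (\<Prod>i<g. f i :: 'k::comm_ring_1)"
proof -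
  have "det (mat_diag g f) = prod_list (diag_mat (mat_diag g f))"
    by (rule det_upper_triangular[of _ g]) (auto simp: mat_diag_def)
  thus ?thesis by (simp add: prod_list_diag_prod mat_diag_def atLeast0LessThan)
qed

text \<open>The inner factors \<open>transpose_mat P * transpose_mat P'\<close> cancel. Up to a
  scalar, adjugates transform by the dual congruence with \<open>P'\<close>, so a congruence of the
  \<open>Q_k\<close> becomes a conjugation of their \<open>pi_map\<close>.\<close>

lemma congr_times_dual:
  fixes P :: "'k::field mat"
  assumes c: "P \<in> carrier_mat g g" "P' \<in> carrier_mat g g" "Y \<in> carrier_mat g g" "Z \<in> carrier_mat g g"
    and inv: "P' * P = 1\<^sub>m g"
  shows "(P * Y * transpose_mat P) * (transpose_mat P' * Z * P') = P * (Y * Z) * P'"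
proof -
  have t: "transpose_mat P * transpose_mat P' = 1\<^sub>m g"
    using transpose_mult[OF c(2,1)] inv by simp
  have key: "transpose_mat P * (transpose_mat P' * W) = W" if "W \<in> carrier_mat g g" for W
    using that c t by (simp flip: assoc_mult_mat[of _ g g _ g _ g])
  show ?thesis using c by (simp add: assoc_mult_mat[of _ g g _ g _ g] key)
qed

text \<open>A root that occurs twice in the factorisation is also a root of the derivative, so the
  \<open>g\<close> linear factors belong to different roots.\<close>

lemma distinct_rootsE:
  fixes p :: "'k::alg_closed_field poly"
  assumes deg: "degree p = g" and p0: "p \<noteq> 0"
    and sqfree: "\<And>a. \<not> (poly p a = 0 \<and> poly (pderiv p) a = 0)"
  obtains a where "inj_on a {..<g}" "\<And>i. i < g \<Longrightarrow> poly p (a i) = 0"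
proof -
  from alg_closed_imp_factorization[OF p0] obtain A where A: "size A = g"
    "p = smult (lead_coeff p) (\<Prod>x\<in>#A. [:-x, 1:])" using deg by auto
  have root: "poly p x = 0" if "x \<in># A" for x
    using that by (subst A(2)) (auto simp: poly_prod_mset prod_mset_zero_iff)
  have "count A x \<le> 1" for x
  proof (rule ccontr)
    assume "\<not> count A x \<le> 1"
    then obtain A' where A': "A = add_mset x (add_mset x A')"
      by (metis One_nat_def Suc_leI count_greater_zero_iff insert_DiffM le_0_eq linorder_not_less
          in_diff_count add_mset_remove_trivial count_single nat_less_le not_less_zero in_diffD less_one nle_le)
    define q where "q = smult (lead_coeff p) (\<Prod>x\<in>#A'. [:-x, 1:])"
    have "p = [:-x, 1:] * ([:-x, 1:] * q)"
      by (subst A(2)) (simp add: A' q_def)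
    hence "pderiv p = [:-x, 1:] * pderiv ([:-x, 1:] * q) + ([:-x, 1:] * q) * pderiv [:-x, 1:]"
      by (metis pderiv_mult)
    hence "poly (pderiv p) x = 0" by simp
    moreover have "poly p x = 0" using A' by (intro root) auto
    ultimately show False using sqfree by blast
  qed
  hence "mset_set (set_mset A) = A"
    by (intro multiset_eqI) (metis count_eq_zero_iff count_mset_set finite_set_mset le_antisym
        less_one linorder_not_le not_in_iff One_nat_def)
  hence "card (set_mset A) = g" using A(1) by (metis size_mset_set)
  then obtain h where "bij_betw h {..<g} (set_mset A)"
    using ex_bij_betw_nat_finite[of "set_mset A"] by (auto simp: atLeast0LessThan)
  thus ?thesis using that[of h] root by (auto simp: bij_betw_def)
qed

lemma det_eigenvector_matrix:
  fixes M V :: "'k::field mat"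
  assumes M: "M \<in> carrier_mat g g" and V: "V \<in> carrier_mat g g"
    and eig: "M * V = V * mat_diag g a" and inj: "inj_on a {..<g}"
    and nz: "\<And>j. j < g \<Longrightarrow> \<exists>r<g. V $$ (r, j) \<noteq> 0"
  shows "det V \<noteq> 0"
proof
  assume "det V = 0"
  then obtain c where c: "c \<in> carrier_vec g" "c \<noteq> 0\<^sub>v g" "V *\<^sub>v c = 0\<^sub>v g"
    using det_0_iff_vec_prod_zero[OF V] by blast
  have MV: "(\<Sum>s<g. M $$ (r, s) * V $$ (s, j)) = V $$ (r, j) * a j" if "r < g" "j < g" for r j
  proof -
    have "(M * V) $$ (r, j) = (\<Sum>s<g. M $$ (r, s) * V $$ (s, j))"
      using that M V by (auto simp: scalar_prod_def atLeast0LessThan intro!: sum.cong)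
    moreover have "(V * mat_diag g a) $$ (r, j) = V $$ (r, j) * a j"
      using that V by (simp add: mat_diag_mult_right[OF V])
    ultimately show ?thesis using eig by simp
  qed
  \<comment> \<open>Applying the product of the \<open>M - a l\<close>, \<open>l\<close> in
    \<open>S\<close>, to the relation \<open>V *\<^sub>v c = 0\<close> multiplies the term of column
    \<open>j\<close> by the product of the \<open>a j - a l\<close>. Taking for \<open>S\<close> all
    indices but one isolates a single column.\<close>
  have zero: "(\<Sum>j<g. V $$ (r, j) * (c $ j * (\<Prod>l\<in>S. a j - a l))) = 0"
    if "r < g" "finite S" for r S
    using that(2,1)
  proof (induction S arbitrary: r)
    case empty
    have "(V *\<^sub>v c) $ r = (\<Sum>j<g. V $$ (r, j) * c $ j)"
      using empty V c(1) by (auto simp: scalar_prod_def atLeast0LessThan intro!: sum.cong)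
    thus ?case using c(3) empty by simp
  next
    case (insert l S)
    let ?w = "\<lambda>j. c $ j * (\<Prod>l\<in>S. a j - a l)"
    have "(\<Sum>j<g. V $$ (r, j) * (c $ j * (\<Prod>l\<in>insert l S. a j - a l))) =
        (\<Sum>j<g. V $$ (r, j) * a j * ?w j) - a l * (\<Sum>j<g. V $$ (r, j) * ?w j)"
      unfolding sum_distrib_left sum_subtractf[symmetric]
      using insert.hyps by (intro sum.cong) (auto simp: algebra_simps)
    also have "(\<Sum>j<g. V $$ (r, j) * a j * ?w j) = (\<Sum>j<g. \<Sum>s<g. M $$ (r, s) * V $$ (s, j) * ?w j)"
      using insert.prems by (intro sum.cong) (auto simp flip: MV simp: sum_distrib_right)
    also have "\<dots> = (\<Sum>s<g. M $$ (r, s) * (\<Sum>j<g. V $$ (s, j) * ?w j))"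
      unfolding sum_distrib_left by (subst sum.swap) (simp add: mult.assoc)
    also have "\<dots> = 0" using insert.IH by simp
    finally show ?case using insert.IH[OF insert.prems] by simp
  qed
  have "c $ j = 0" if j: "j < g" for j
  proof -
    obtain r where r: "r < g" "V $$ (r, j) \<noteq> 0" using nz[OF j] by blast
    let ?S = "{..<g} - {j}"
    have "(\<Prod>l\<in>?S. a i - a l) = 0" if "i < g" "i \<noteq> j" for i
      using that by (intro prod_zero) auto
    hence "(\<Sum>i<g. V $$ (r, i) * (c $ i * (\<Prod>l\<in>?S. a i - a l))) =
        (\<Sum>i<g. if i = j then V $$ (r, j) * (c $ j * (\<Prod>l\<in>?S. a j - a l)) else 0)"
      by (intro sum.cong) auto
    hence "V $$ (r, j) * (c $ j * (\<Prod>l\<in>?S. a j - a l)) = 0"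
      using zero[OF r(1), of ?S] j by simp
    moreover have "(\<Prod>l\<in>?S. a j - a l) \<noteq> 0"
      using inj j by (auto simp: prod_zero_iff inj_on_def)
    ultimately show ?thesis using r(2) by simp
  qed
  thus False using c(1,2) by (auto intro!: eq_vecI)
qed

text \<open>Solutions of \<open>A w = (a / det B) B w\<close> for different \<open>a\<close> are
  orthogonal for both symmetric forms, because \<open>(a i - a j)\<close> times their pairing
  vanishes. Hence one basis diagonalises both forms, and rescaling it turns \<open>B\<close> into
  the identity.\<close>

lemma symmetric_pencil_diagonal:
  fixes A B :: "'k::alg_closed_field mat"
  assumes A: "A \<in> sym_mats g" and B: "B \<in> sym_mats g" and det: "det B \<noteq> 0"
    and sqfree: "\<And>a. \<not> (poly (char_poly (A * adj_mat B)) a = 0 \<and> poly (pderiv (char_poly (A * adj_mat B))) a = 0)"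
  obtains P d where "P \<in> carrier_mat g g" "det P \<noteq> 0"
    "P * B * transpose_mat P = 1\<^sub>m g" "P * A * transpose_mat P = mat_diag g d"
proof -
  have Ac: "A \<in> carrier_mat g g" and At: "transpose_mat A = A"
    and Bc: "B \<in> carrier_mat g g" and Bt: "transpose_mat B = B"
    using A B by (auto simp: sym_mats_def)
  note adj = adj_mat[OF Bc]
  define M where "M = A * adj_mat B"
  have M: "M \<in> carrier_mat g g" using Ac adj(1) by (simp add: M_def)
  have "degree (char_poly M) = g" "char_poly M \<noteq> 0" using degree_monic_char_poly[OF M] by auto
  then obtain a where a: "inj_on a {..<g}" "\<And>i. i < g \<Longrightarrow> poly (char_poly M) (a i) = 0"
    using distinct_rootsE[of "char_poly M" g] sqfree unfolding M_def by metis
  have "\<exists>v. v \<in> carrier_vec g \<and> v \<noteq> 0\<^sub>v g \<and> M *\<^sub>v v = a i \<cdot>\<^sub>v v" if "i < g" for i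
    using a(2)[OF that] M unfolding eigenvalue_root_char_poly[OF M, symmetric]
    by (auto simp: eigenvalue_def eigenvector_def)
  then obtain v where v: "\<And>i. i < g \<Longrightarrow> v i \<in> carrier_vec g" "\<And>i. i < g \<Longrightarrow> v i \<noteq> 0\<^sub>v g"
    "\<And>i. i < g \<Longrightarrow> M *\<^sub>v v i = a i \<cdot>\<^sub>v v i" by metis
  define V where "V = mat g g (\<lambda>(r, j). v j $ r)"
  have V: "V \<in> carrier_mat g g" by (simp add: V_def)
  have MV: "M * V = V * mat_diag g a"
  proof (rule eq_matI)
    fix r j assume "r < dim_row (V * mat_diag g a)" "j < dim_col (V * mat_diag g a)"
    hence rj: "r < g" "j < g" by (auto simp: V_def mat_diag_def)
    have "col V j = v j" using rj v(1)[OF rj(2)] by (auto simp: V_def intro!: eq_vecI)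
    hence "(M * V) $$ (r, j) = (M *\<^sub>v v j) $ r" using rj M V by simp
    also have "\<dots> = a j * v j $ r" using rj v(1,3)[OF rj(2)] by simp
    also have "\<dots> = (V * mat_diag g a) $$ (r, j)"
      using rj by (simp add: mat_diag_mult_right[OF V]) (simp add: V_def)
    finally show "(M * V) $$ (r, j) = (V * mat_diag g a) $$ (r, j)" .
  qed (use M V in \<open>auto simp: mat_diag_def\<close>)
  have detV: "det V \<noteq> 0"
  proof (rule det_eigenvector_matrix[OF M V MV a(1)])
    fix j assume j: "j < g"
    show "\<exists>r<g. V $$ (r, j) \<noteq> 0"
    proof (rule ccontr)
      assume "\<not> (\<exists>r<g. V $$ (r, j) \<noteq> 0)"
      hence "v j = 0\<^sub>v g" using j v(1)[OF j] by (intro eq_vecI) (auto simp: V_def)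
      thus False using v(2)[OF j] by simp
    qed
  qed
  \<comment> \<open>Turns eigenvectors of \<open>A * adj_mat B\<close> into those of the pencil: a
    column \<open>v\<close> of \<open>V\<close> with eigenvalue \<open>a\<close> gives
    \<open>w\<close> with \<open>A w = a v\<close> and \<open>B w = det B v\<close>.\<close>
  define W where "W = adj_mat B * V"
  have W: "W \<in> carrier_mat g g" using adj(1) V by (simp add: W_def)
  have Wt: "transpose_mat W \<in> carrier_mat g g" using W by simp
  have BW: "B * W = det B \<cdot>\<^sub>m V"
    unfolding W_def using Bc adj V
    by (simp flip: assoc_mult_mat[of _ g g _ g _ g] add: mult_smult_assoc_mat[of _ g g _ g])
  have AW: "A * W = V * mat_diag g a"
    unfolding W_def MV[symmetric] M_def using Ac adj V by (simp add: assoc_mult_mat[of _ g g _ g _ g])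
  \<comment> \<open>Both forms are expressed through \<open>U\<close>: \<open>B\<close> becomes
    \<open>det B\<close> times \<open>U\<close>, and \<open>A\<close> becomes
    \<open>U * mat_diag g a\<close>. Symmetry of both matrices forces \<open>U\<close> to be
    diagonal.\<close>
  define U where "U = transpose_mat W * V"
  have U: "U \<in> carrier_mat g g" using W V by (simp add: U_def)
  have WBW: "transpose_mat W * B * W = det B \<cdot>\<^sub>m U"
    using Wt Bc W V by (simp add: assoc_mult_mat[of _ g g _ g _ g] BW mult_smult_distrib[of _ g g _ g] U_def)
  have WAW: "transpose_mat W * A * W = U * mat_diag g a"
    using Wt Ac W V by (simp add: assoc_mult_mat[of _ g g _ g _ g] AW U_def)
  have symm: "transpose_mat (transpose_mat W * X * W) = transpose_mat W * X * W"
    if "X \<in> carrier_mat g g" "transpose_mat X = X" for X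
    using that W Wt by (simp add: transpose_mult[of _ g g _ g] assoc_mult_mat[of _ g g _ g _ g])
  have Usym: "U $$ (i, j) = U $$ (j, i)" if "i < g" "j < g" for i j
    using arg_cong[OF symm[OF Bc Bt], of "\<lambda>X. X $$ (i, j)"] that U det unfolding WBW by simp
  have Udiag: "U $$ (i, j) = 0" if ij: "i < g" "j < g" "i \<noteq> j" for i j
  proof -
    have "U $$ (j, i) * a i = U $$ (i, j) * a j"
      using arg_cong[OF symm[OF Ac At], of "\<lambda>X. X $$ (i, j)"] ij U unfolding WAW
      by (simp add: mat_diag_mult_right[OF U])
    hence "U $$ (i, j) * (a i - a j) = 0" using Usym[OF ij(1,2)] by (simp add: algebra_simps)
    moreover have "a i \<noteq> a j" using a(1) ij by (auto simp: inj_on_def)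
    ultimately show ?thesis by simp
  qed
  define u where "u i = U $$ (i, i)" for i
  have Ueq: "U = mat_diag g u" using U Udiag by (intro eq_matI) (auto simp: mat_diag_def u_def)
  have "det (adj_mat B) * det B = det B ^ g"
    using arg_cong[OF adj(3), of det] det_mult[OF adj(1) Bc] by simp
  hence "det (adj_mat B) \<noteq> 0" using det by (metis mult_zero_left power_not_zero)
  hence detW: "det W \<noteq> 0" using detV det_mult[OF adj(1) V] by (simp add: W_def)
  have "det U = det W * det V" using det_mult[OF Wt V] det_transpose[OF W] by (simp add: U_def)
  hence "(\<Prod>i<g. u i) \<noteq> 0" using detW detV by (simp add: Ueq det_mat_diag)
  hence u: "u i \<noteq> 0" if "i < g" for i using that by (auto simp: prod_zero_iff)
  \<comment> \<open>\<open>det B * u i\<close> is the value of the form \<open>B\<close> on the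
    \<open>i\<close>-th column of \<open>W\<close>; dividing the column by \<open>s i\<close> makes
    it 1.\<close>
  have "\<exists>s. s ^ 2 = det B * u i" for i by (rule nth_root_exists) simp
  then obtain s where s: "\<And>i. s i ^ 2 = det B * u i" by metis
  have s0: "s i \<noteq> 0" if "i < g" for i using s[of i] u[OF that] det by auto
  define C where "C = mat_diag g (\<lambda>i. 1 / s i)"
  have C: "C \<in> carrier_mat g g" and Ct: "transpose_mat C = C"
    by (auto simp: C_def mat_diag_transpose)
  define P where "P = C * transpose_mat W"
  have P: "P \<in> carrier_mat g g" using C Wt by (simp add: P_def)
  have Pt: "transpose_mat P = W * C" using transpose_mult[OF C Wt] Ct by (simp add: P_def)
  have PXP: "P * X * transpose_mat P = C * (transpose_mat W * X * W) * C" if "X \<in> carrier_mat g g" for X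
    unfolding Pt unfolding P_def using that C W Wt by (simp add: assoc_mult_mat[of _ g g _ g _ g])
  show ?thesis
  proof (rule that[OF P])
    have "det C \<noteq> 0" unfolding C_def det_mat_diag using s0 by (auto simp: prod_zero_iff)
    thus "det P \<noteq> 0" unfolding P_def using det_mult[OF C Wt] detW det_transpose[OF W] by simp
    have "P * B * transpose_mat P = C * (det B \<cdot>\<^sub>m mat_diag g u) * C"
      by (simp add: PXP[OF Bc] WBW Ueq)
    also have "det B \<cdot>\<^sub>m mat_diag g u = mat_diag g (\<lambda>i. det B * u i)"
      by (rule eq_matI) (auto simp: mat_diag_def)
    also have "C * \<dots> * C = mat_diag g (\<lambda>i. 1 / s i * (det B * u i) * (1 / s i))" by (simp add: C_def)
    also have "\<dots> = 1\<^sub>m g"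
      using s0 by (intro eq_matI) (auto simp: mat_diag_def power2_eq_square simp flip: s)
    finally show "P * B * transpose_mat P = 1\<^sub>m g" .
    show "P * A * transpose_mat P = mat_diag g (\<lambda>i. 1 / s i * (u i * a i) * (1 / s i))"
      by (simp add: PXP[OF Ac] WAW Ueq C_def)
  qed
qed

section \<open>The slice\<close>

lemma smult_mult_smult_mat:
  fixes A B :: "'k::field mat"
  assumes "A \<in> carrier_mat g g" "B \<in> carrier_mat g g"
  shows "(a \<cdot>\<^sub>m A) * (b \<cdot>\<^sub>m B) = (a * b) \<cdot>\<^sub>m (A * B)"
  using mult_smult_distrib[OF smult_carrier_mat[OF assms(1)] assms(2)] mult_smult_assoc_mat[OF assms]
  by (auto intro!: eq_matI)

text \<open>Scalars act trivially by conjugation, and \<open>P\<close> divided by a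
  \<open>g\<close>-th root of its determinant lies in \<open>SL_mats g\<close>. So invariance under
  the special linear group gives invariance under all invertible matrices.\<close>

lemma mat_invariants_GL:
  fixes f :: "(nat \<Rightarrow> 'k::alg_closed_field mat) \<Rightarrow> 'k"
  assumes f: "f \<in> carrier (mat_invariants g n)" and g: "g \<ge> 1" and M: "M \<in> mat_tuples g n"
    and P: "P \<in> carrier_mat g g" and P': "P' \<in> carrier_mat g g" and PP': "P * P' = 1\<^sub>m g"
  shows "f (\<lambda>k\<in>{..<n}. P * M k * P') = f M"
proof -
  have "det P * det P' = 1" using arg_cong[OF PP', of det] det_mult[OF P P'] by simp
  hence detP: "det P \<noteq> 0" by auto
  obtain \<mu> where \<mu>: "\<mu> ^ g = det P" using nth_root_exists[of g "det P"] g by auto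
  have \<mu>0: "\<mu> \<noteq> 0" using \<mu> detP g by (auto simp: power_0_left)
  define L where "L = (1 / \<mu>) \<cdot>\<^sub>m P"
  have L: "L \<in> carrier_mat g g" using P by (simp add: L_def)
  have "det L = 1" using P \<mu> \<mu>0 detP by (simp add: L_def power_one_over)
  hence SL: "L \<in> SL_mats g" using L by (simp add: SL_mats_def)
  have "L * (\<mu> \<cdot>\<^sub>m P') = 1\<^sub>m g"
    using P P' PP' \<mu>0 unfolding L_def
    by (simp add: mult_smult_assoc_mat[of _ g g _ g] mult_smult_distrib[of _ g g _ g])
       (auto intro!: eq_matI)
  from mat_inverse_eq[OF L _ this] have inv: "mat_inverse L = Some (\<mu> \<cdot>\<^sub>m P')" using P' by simp
  have "conj_act n L M = (\<lambda>k\<in>{..<n}. P * M k * P')"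
  proof
    fix k
    show "conj_act n L M k = (\<lambda>k\<in>{..<n}. P * M k * P') k"
    proof (cases "k < n")
      case True
      hence Mk: "M k \<in> carrier_mat g g" using M by (auto simp: mat_tuples_def)
      have "L * M k * (\<mu> \<cdot>\<^sub>m P') = (1 / \<mu> * \<mu>) \<cdot>\<^sub>m (P * M k * P')"
        using P P' Mk unfolding L_def
        by (simp add: mult_smult_assoc_mat[of _ g g _ g] mult_smult_distrib[of _ g g _ g])
           (auto intro!: eq_matI)
      also have "\<dots> = P * M k * P'" using \<mu>0 P P' Mk by (auto intro!: eq_matI)
      finally show ?thesis using True by (simp add: conj_act_def inv)
    qed (simp add: conj_act_def)
  qed
  moreover have "f (conj_act n L M) = f M"
    using f SL M by (simp add: mat_invariants_def)
  ultimately show ?thesis by simp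
qed

lemma pi_map_in_mat_tuples:
  assumes "Q \<in> sym_tuples g n"
  shows "pi_map n Q \<in> mat_tuples g n"
proof -
  have "Q k * adj_mat (Q (Suc k)) \<in> carrier_mat g g" if "k < n" for k
  proof -
    have "Q k \<in> carrier_mat g g" "Q (Suc k) \<in> carrier_mat g g"
      using assms that by (auto simp: sym_tuples_def sym_mats_def PiE_iff)
    thus ?thesis using adj_mat(1) by (intro mult_carrier_mat) auto
  qed
  thus ?thesis by (auto simp: pi_map_def mat_tuples_def)
qed

text \<open>The coordinates of the slice are \<open>(0, i, i)\<close> for the diagonal of \<open>Q\<^sub>n\<^sub>-\<^sub>1\<close> and \<open>(Suc k, i, j)\<close>, \<open>i \<le> j\<close>,
  for \<open>Q\<^sub>k\<close>, so that their lexicographic order is the order in which the lower bound fixes them.\<close>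

definition slice :: "nat \<Rightarrow> nat \<Rightarrow> (nat \<times> nat \<times> nat \<Rightarrow> 'k::field) \<Rightarrow> nat \<Rightarrow> 'k mat" where
  "slice g n \<tau> = (\<lambda>k\<in>{..n}. if k = n then 1\<^sub>m g
     else if Suc k = n then mat_diag g (\<lambda>i. \<tau> (0, i, i))
     else mat g g (\<lambda>(i, j). \<tau> (Suc k, min i j, max i j)))"

lemma slice_in_sym_tuples: "slice g n \<tau> \<in> sym_tuples g n"
proof -
  have "mat g g (\<lambda>(i, j). \<tau> (Suc k, min i j, max i j)) \<in> sym_mats g" for k
    by (auto simp: sym_mats_def min.commute max.commute intro!: eq_matI)
  moreover have "mat_diag g (\<lambda>i. \<tau> (0, i, i)) \<in> sym_mats g"
    by (simp add: sym_mats_def mat_diag_transpose)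
  moreover have "1\<^sub>m g \<in> sym_mats g" by (simp add: sym_mats_def)
  ultimately show ?thesis by (auto simp: slice_def sym_tuples_def)
qed

text \<open>Compensates the factor \<open>\<delta>\<^sup>2 = (det P)\<^sup>2\<close> by which a congruence with \<open>P\<close> misses conjugation of
  \<open>Q\<^sub>k Q\<^sub>k\<^sub>+\<^sub>1\<^sup>*\<close>; the index counts down from \<open>Q\<^sub>n\<close>.\<close>

primrec rescaling :: "nat \<Rightarrow> 'k::field \<Rightarrow> nat \<Rightarrow> 'k" where
  "rescaling g \<delta> 0 = 1"
| "rescaling g \<delta> (Suc m) = 1 / (\<delta>\<^sup>2 * rescaling g \<delta> m ^ (g - 1))"

lemma rescaling_nonzero: "\<delta> \<noteq> 0 \<Longrightarrow> rescaling g \<delta> m \<noteq> 0"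
  by (induction m) auto

text \<open>The adjugate is homogeneous of degree \<open>g - 1\<close>, so scaling by
  \<open>s\<close> multiplies the \<open>k\<close>-th component of \<open>pi_map\<close> by
  \<open>s k * s (Suc k) ^ (g - 1)\<close>, while the congruence with \<open>P\<close> contributes
  \<open>(det P)\<^sup>2\<close>. With all these factors equal to 1, what remains is conjugation
  with \<open>P\<close>. Scaling leaves the component \<open>n - 1\<close> diagonal.\<close>

lemma slice_reaches:
  fixes Q :: "nat \<Rightarrow> 'k::alg_closed_field mat"
  assumes g: "g \<ge> 1" and n: "n \<ge> 1" and Q: "Q \<in> sym_tuples g n"
    and dets: "\<And>k. k \<le> n \<Longrightarrow> det (Q k) \<noteq> 0"
    and sqfree: "\<And>a. \<not> (poly (char_poly (pi_map n Q (n - 1))) a = 0 \<and>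
       poly (pderiv (char_poly (pi_map n Q (n - 1)))) a = 0)"
  obtains \<tau> where "\<And>f. f \<in> carrier (mat_invariants g n) \<Longrightarrow> f (pi_map n Q) = f (pi_map n (slice g n \<tau>))"
proof -
  have Qsym: "Q k \<in> sym_mats g" if "k \<le> n" for k using Q that by (auto simp: sym_tuples_def)
  have Qc: "Q k \<in> carrier_mat g g" and Qt: "transpose_mat (Q k) = Q k" if "k \<le> n" for k
    using Qsym[OF that] by (auto simp: sym_mats_def)
  have "pi_map n Q (n - 1) = Q (n - 1) * adj_mat (Q n)" using n by (simp add: pi_map_def)
  then obtain P d where P: "P \<in> carrier_mat g g" "det P \<noteq> 0"
    "P * Q n * transpose_mat P = 1\<^sub>m g" "P * Q (n - 1) * transpose_mat P = mat_diag g d"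
    using symmetric_pencil_diagonal[OF Qsym Qsym dets, of "n - 1" n] sqfree by auto
  obtain P' where P': "P' \<in> carrier_mat g g" "P * P' = 1\<^sub>m g" "P' * P = 1\<^sub>m g"
    using inverse_matE[OF P(1,2)] by blast
  note PT = transpose_carrier_mat[THEN iffD2, OF P(1)]
  \<comment> \<open>Counting from the end gives \<open>s n = 1\<close>, so the last component stays
    the identity; the other factors are then determined by \<open>s_rec\<close>.\<close>
  define s where "s k = rescaling g (det P) (n - k)" for k
  have s0: "s k \<noteq> 0" for k unfolding s_def by (rule rescaling_nonzero[OF P(2)])
  have s_rec: "s k * (s (Suc k) ^ (g - 1) * (det P)\<^sup>2) = 1" if "k < n" for k
  proof -
    have "n - k = Suc (n - Suc k)" using that by simp
    thus ?thesis using P(2) s0[of "Suc k"] by (simp add: s_def)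
  qed
  define R where "R = (\<lambda>k\<in>{..n}. s k \<cdot>\<^sub>m (P * Q k * transpose_mat P))"
  have Rc: "R k \<in> carrier_mat g g" if "k \<le> n" for k
    using that P(1) Qc[OF that] by (simp add: R_def)
  have adjR: "adj_mat (R k) = (s k ^ (g - 1) * (det P)\<^sup>2) \<cdot>\<^sub>m (transpose_mat P' * adj_mat (Q k) * P')"
    if k: "k \<le> n" for k
  proof (rule adj_mat_unique[OF Rc[OF k]])
    note q = Qc[OF k] adj_mat[OF Qc[OF k]]
    let ?X = "transpose_mat P' * adj_mat (Q k) * P'"
    have PQP: "P * Q k * transpose_mat P \<in> carrier_mat g g" using P q by simp
    have Xc: "?X \<in> carrier_mat g g" using P' q by simp
    show "(s k ^ (g - 1) * (det P)\<^sup>2) \<cdot>\<^sub>m ?X \<in> carrier_mat g g" using Xc by simp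
    have "det (P * Q k * transpose_mat P) = det P * det (Q k) * det P"
      using P(1) q by (simp add: det_mult[of _ g] det_transpose[OF P(1)])
    hence detR: "det (R k) = s k ^ g * ((det P)\<^sup>2 * det (Q k))"
      using k P(1) PQP by (simp add: R_def power2_eq_square)
    thus "det (R k) \<noteq> 0" using s0 P(2) dets[OF k] by simp
    have "R k * ((s k ^ (g - 1) * (det P)\<^sup>2) \<cdot>\<^sub>m ?X) =
        (s k * (s k ^ (g - 1) * (det P)\<^sup>2)) \<cdot>\<^sub>m ((P * Q k * transpose_mat P) * ?X)"
      using k smult_mult_smult_mat[OF PQP Xc] by (simp add: R_def)
    also have "(P * Q k * transpose_mat P) * ?X = P * (det (Q k) \<cdot>\<^sub>m 1\<^sub>m g) * P'"
      using congr_times_dual[OF P(1) P'(1) q(1,2) P'(3)] q(3) by simp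
    also have "\<dots> = det (Q k) \<cdot>\<^sub>m 1\<^sub>m g"
      using P(1) P'(1,2) by (simp add: mult_smult_distrib[of _ g g _ g] mult_smult_assoc_mat[of _ g g _ g])
    also have "(s k * (s k ^ (g - 1) * (det P)\<^sup>2)) \<cdot>\<^sub>m (det (Q k) \<cdot>\<^sub>m 1\<^sub>m g) = det (R k) \<cdot>\<^sub>m 1\<^sub>m g"
    proof -
      have "s k * s k ^ (g - 1) = s k ^ g" using g by (metis One_nat_def Suc_le_eq power_minus_mult mult.commute)
      hence "det (R k) = s k * (s k ^ (g - 1) * (det P)\<^sup>2) * det (Q k)" by (simp add: detR mult.assoc[symmetric])
      thus ?thesis by (auto intro!: eq_matI)
    qed
    finally show "R k * ((s k ^ (g - 1) * (det P)\<^sup>2) \<cdot>\<^sub>m ?X) = det (R k) \<cdot>\<^sub>m 1\<^sub>m g" .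
  qed
  have piR: "pi_map n R = (\<lambda>k\<in>{..<n}. P * pi_map n Q k * P')"
  proof
    fix k
    show "pi_map n R k = (\<lambda>k\<in>{..<n}. P * pi_map n Q k * P') k"
    proof (cases "k < n")
      case True
      hence k: "k \<le> n" "Suc k \<le> n" by auto
      note q = Qc[OF k(1)] adj_mat(1)[OF Qc[OF k(2)]]
      let ?X = "transpose_mat P' * adj_mat (Q (Suc k)) * P'"
      let ?c = "s (Suc k) ^ (g - 1) * (det P)\<^sup>2"
      have PQP: "P * Q k * transpose_mat P \<in> carrier_mat g g" using P q by simp
      have Xc: "?X \<in> carrier_mat g g" using P' q by simp
      have "R k * adj_mat (R (Suc k)) = (s k * ?c) \<cdot>\<^sub>m ((P * Q k * transpose_mat P) * ?X)"
        unfolding adjR[OF k(2)] using k smult_mult_smult_mat[OF PQP Xc] by (simp add: R_def)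
      also have "\<dots> = (P * Q k * transpose_mat P) * ?X"
        unfolding s_rec[OF True] by (auto intro!: eq_matI)
      also have "\<dots> = P * (Q k * adj_mat (Q (Suc k))) * P'"
        by (rule congr_times_dual[OF P(1) P'(1) q P'(3)])
      finally show ?thesis using True by (simp add: pi_map_def)
    qed (simp add: pi_map_def)
  qed
  define \<tau> where "\<tau> = (\<lambda>(k, i, j). if k = 0 then R (n - 1) $$ (i, i) else R (k - 1) $$ (i, j))"
  have "R = slice g n \<tau>"
  proof
    fix k
    consider "k = n" | "Suc k = n" | "Suc k < n" | "k > n" by linarith
    thus "R k = slice g n \<tau> k"
    proof cases
      case 1
      have "s n = 1" by (simp add: s_def)
      thus ?thesis using 1 P(3) by (simp add: R_def slice_def) (auto intro!: eq_matI)
    next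
      case 2
      have "R (n - 1) = s (n - 1) \<cdot>\<^sub>m mat_diag g d" using P(4) by (simp add: R_def)
      hence *: "R (n - 1) = mat_diag g (\<lambda>i. s (n - 1) * d i)"
        by (auto simp: mat_diag_def intro!: eq_matI)
      have "k = n - 1" using 2 by simp
      thus ?thesis using 2 * by (auto simp: slice_def \<tau>_def mat_diag_def intro!: eq_matI)
    next
      case 3
      hence k: "k \<le> n" by simp
      let ?Y = "P * Q k * transpose_mat P"
      have Y: "?Y \<in> carrier_mat g g" using P(1) Qc[OF k] by simp
      have "transpose_mat ?Y = ?Y"
        using P(1) Qc[OF k] Qt[OF k]
        by (simp add: transpose_mult[of _ g g _ g] assoc_mult_mat[of _ g g _ g _ g])
      hence "?Y $$ (i, j) = ?Y $$ (j, i)" if "i < g" "j < g" for i j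
        using that Y by (metis carrier_matD index_transpose_mat(1))
      hence "R k $$ (i, j) = R k $$ (j, i)" if "i < g" "j < g" for i j
        using that k Y P(1) by (simp add: R_def del: index_mult_mat)
      hence "R k $$ (min i j, max i j) = R k $$ (i, j)" if "i < g" "j < g" for i j
        using that by (auto simp: min_def max_def)
      thus ?thesis using 3 Rc[OF k] by (auto simp: slice_def \<tau>_def intro!: eq_matI)
    next
      case 4
      thus ?thesis by (simp add: R_def slice_def)
    qed
  qed
  hence "f (pi_map n Q) = f (pi_map n (slice g n \<tau>))" if "f \<in> carrier (mat_invariants g n)" for f
    using mat_invariants_GL[OF that g pi_map_in_mat_tuples[OF Q] P(1) P'(1,2)] piR by simp
  thus ?thesis by (rule that)
qed

section \<open>Density of the orbit of the slice\<close>

fun mat_poly :: "nat \<Rightarrow> 'k::field mat \<Rightarrow> (nat \<Rightarrow> 'k) \<Rightarrow> nat \<Rightarrow> 'k mat" where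
  "mat_poly g M c 0 = 0\<^sub>m g g"
| "mat_poly g M c (Suc m) = c 0 \<cdot>\<^sub>m 1\<^sub>m g + M * mat_poly g M (\<lambda>i. c (Suc i)) m"

lemma mat_poly_carrier: "M \<in> carrier_mat g g \<Longrightarrow> mat_poly g M c m \<in> carrier_mat g g"
  by (induction m arbitrary: c) auto

lemma mat_poly_eigenvector:
  assumes M: "M \<in> carrier_mat g g" and v: "v \<in> carrier_vec g" "M *\<^sub>v v = a \<cdot>\<^sub>v v"
  shows "mat_poly g M c m *\<^sub>v v = (\<Sum>i<m. c i * a ^ i) \<cdot>\<^sub>v v"
proof (induction m arbitrary: c)
  case 0
  show ?case using v(1) by (auto intro!: eq_vecI)
next
  case (Suc m)
  let ?H = "mat_poly g M (\<lambda>i. c (Suc i)) m"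
  have H: "?H \<in> carrier_mat g g" by (rule mat_poly_carrier[OF M])
  have "mat_poly g M c (Suc m) *\<^sub>v v = (c 0 \<cdot>\<^sub>m 1\<^sub>m g) *\<^sub>v v + (M * ?H) *\<^sub>v v"
    using M H v(1) by (simp add: add_mult_distrib_mat_vec[of _ g g])
  also have "(c 0 \<cdot>\<^sub>m 1\<^sub>m g) *\<^sub>v v = c 0 \<cdot>\<^sub>v v"
    using v(1) by (intro eq_vecI) auto
  also have "(M * ?H) *\<^sub>v v = M *\<^sub>v (?H *\<^sub>v v)"
    by (rule assoc_mult_mat_vec[OF M H v(1)])
  also have "\<dots> = (\<Sum>i<m. c (Suc i) * a ^ i) \<cdot>\<^sub>v (a \<cdot>\<^sub>v v)"
    unfolding Suc.IH v(2)[symmetric] by (rule mult_mat_vec[OF M v(1)])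
  also have "c 0 \<cdot>\<^sub>v v + \<dots> = (\<Sum>i<Suc m. c i * a ^ i) \<cdot>\<^sub>v v"
    using v(1) by (intro eq_vecI) (auto simp: sum.lessThan_Suc_shift sum_distrib_right sum_distrib_left
        algebra_simps simp del: sum.lessThan_Suc)
  finally show ?case .
qed

lemma mat_poly_diag: "mat_poly g (mat_diag g \<alpha>) c m = mat_diag g (\<lambda>r. \<Sum>i<m. c i * \<alpha> r ^ i)"
proof (induction m arbitrary: c)
  case 0
  show ?case by (auto simp: mat_diag_def intro!: eq_matI)
next
  case (Suc m)
  have "c 0 \<cdot>\<^sub>m 1\<^sub>m g + mat_diag g (\<lambda>r. \<alpha> r * (\<Sum>i<m. c (Suc i) * \<alpha> r ^ i)) =
      mat_diag g (\<lambda>r. \<Sum>i<Suc m. c i * \<alpha> r ^ i)"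
    by (intro eq_matI) (auto simp: mat_diag_def sum.lessThan_Suc_shift sum_distrib_left mult_ac
        simp del: sum.lessThan_Suc)
  thus ?case by (simp add: Suc.IH del: sum.lessThan_Suc)
qed

lemma (in function_algebra) matrix_function_mat_poly:
  assumes W: "matrix_function g W" and c: "\<And>i. c i \<in> R"
  shows "matrix_function g (\<lambda>s. mat_poly g (W s) (\<lambda>i. c i s) m)"
  using c
proof (induction m arbitrary: c)
  case 0
  show ?case by (simp add: matrix_function_const)
next
  case (Suc m)
  let ?H = "\<lambda>s. W s * mat_poly g (W s) (\<lambda>i. c (Suc i) s) m"
  have H: "matrix_function g ?H" by (intro matrix_function_mult W Suc.IH Suc.prems)
  show ?case
  proof (rule matrix_functionI)
    fix s assume s: "s \<in> T"
    show "mat_poly g (W s) (\<lambda>i. c i s) (Suc m) \<in> carrier_mat g g"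
      by (rule mat_poly_carrier[OF matrix_functionD(1)[OF W s]])
  next
    fix i j assume ij: "i < g" "j < g"
    have "(\<lambda>s. c 0 s * (if i = j then 1 else 0) + ?H s $$ (i, j)) \<in> R"
      by (intro add_closed mult_closed Suc.prems const_closed matrix_functionD(2)[OF H ij])
    thus "(\<lambda>s. mat_poly g (W s) (\<lambda>i. c i s) (Suc m) $$ (i, j)) \<in> R"
    proof (rule cong_closed)
      fix s assume s: "s \<in> T"
      show "mat_poly g (W s) (\<lambda>i. c i s) (Suc m) $$ (i, j) =
          c 0 s * (if i = j then 1 else 0) + ?H s $$ (i, j)"
        unfolding mat_poly.simps using carrier_matD[OF matrix_functionD(1)[OF H s]] ij
        by (subst index_add_mat(1)) (simp_all del: index_mult_mat)
    qed
  qed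
qed

text \<open>The entries of \<open>W\<close> assemble into one matrix over the polynomial ring, whose
  characteristic polynomial specialises to that of \<open>W t\<close>.\<close>

lemma char_poly_coeff_univariate:
  fixes W :: "'k::field \<Rightarrow> 'k mat"
  assumes W: "univariate.matrix_function g W"
  shows "(\<lambda>t. coeff (char_poly (W t)) i) \<in> range poly"
proof -
  have "\<exists>p. (\<lambda>t. W t $$ (i, j)) = poly p" if "i < g" "j < g" for i j
    using univariate.matrix_functionD(2)[OF W that] by auto
  then obtain p where p: "\<And>i j. i < g \<Longrightarrow> j < g \<Longrightarrow> (\<lambda>t. W t $$ (i, j)) = poly (p i j)" by metis
  define N where "N = mat g g (\<lambda>(i, j). p i j)"
  have N: "N \<in> carrier_mat g g" by (simp add: N_def)
  have "coeff (char_poly (W t)) i = poly (coeff (char_poly N) i) t" for t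
  proof -
    have "W t = map_mat (\<lambda>q. poly q t) N"
      using univariate.matrix_functionD(1)[OF W, of t] p[THEN fun_cong, of _ _ t]
      by (intro eq_matI) (auto simp: N_def)
    thus ?thesis using poly_hom.char_poly_hom[OF N] by simp
  qed
  hence "(\<lambda>t. coeff (char_poly (W t)) i) = poly (coeff (char_poly N) i)" by auto
  thus ?thesis by blast
qed

lemma poly_eq_sum_lessThan:
  fixes p :: "'k::comm_semiring_1 poly"
  assumes "degree p < m"
  shows "poly p x = (\<Sum>i<m. coeff p i * x ^ i)"
  unfolding poly_altdef using assms
  by (intro sum.mono_neutral_left) (auto simp: coeff_eq_0)

lemma char_poly_mat_diag: "char_poly (mat_diag g \<alpha>) = (\<Prod>i<g. [:- \<alpha> i, 1:])"
proof -
  have "char_poly (mat_diag g \<alpha>) = (\<Prod>a\<leftarrow>diag_mat (mat_diag g \<alpha>). [:- a, 1:])"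
    by (rule char_poly_upper_triangular[of _ g]) (auto simp: mat_diag_def)
  also have "diag_mat (mat_diag g \<alpha>) = map \<alpha> [0..<g]"
    by (auto simp: diag_mat_def mat_diag_def)
  finally show ?thesis
    by (simp add: o_def prod.distinct_set_conv_list[symmetric] atLeast0LessThan)
qed

text \<open>With \<open>p\<close> the characteristic polynomial of \<open>M\<close>, the determinant of \<open>p'(M)\<close> is the product of the
  values of \<open>p'\<close> at the eigenvalues, which avoids the discriminant.\<close>

lemma squarefree_char_poly_generic:
  fixes W :: "'k::field \<Rightarrow> 'k mat"
  assumes W: "univariate.matrix_function g W" and g: "g \<ge> 1"
    and W1: "W 1 = mat_diag g \<alpha>" and inj: "inj_on \<alpha> {..<g}"
  obtains h where "poly h 1 \<noteq> 0"
    "\<And>t a. poly h t \<noteq> 0 \<Longrightarrow>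
       \<not> (poly (char_poly (W t)) a = 0 \<and> poly (pderiv (char_poly (W t))) a = 0)"
proof -
  have Wc: "W t \<in> carrier_mat g g" for t using univariate.matrix_functionD(1)[OF W] by simp
  have deg: "degree (char_poly (W t)) = g" for t using degree_monic_char_poly[OF Wc] by blast
  define H where "H t = mat_poly g (W t) (\<lambda>i. coeff (pderiv (char_poly (W t))) i) g" for t
  have H: "H t \<in> carrier_mat g g" for t unfolding H_def by (rule mat_poly_carrier[OF Wc])
  \<comment> \<open>The derivative has degree below \<open>g\<close> because \<open>g\<close> is
    positive, so the \<open>g\<close> coefficients used in \<open>H\<close> are all of them.\<close>
  have pd: "poly (pderiv (char_poly (W t))) a = (\<Sum>i<g. coeff (pderiv (char_poly (W t))) i * a ^ i)" for t a
    using deg[of t] degree_pderiv_le[of "char_poly (W t)"] g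
    by (intro poly_eq_sum_lessThan) linarith
  have "(\<lambda>t. coeff (pderiv (char_poly (W t))) i) \<in> range poly" for i
    unfolding coeff_pderiv by (intro univariate.cmult_closed char_poly_coeff_univariate[OF W])
  hence "univariate.matrix_function g H"
    unfolding H_def by (intro univariate.matrix_function_mat_poly W)
  from univariate.det_closed[OF this] obtain h where h: "(\<lambda>t. det (H t)) = poly h" by auto
  show ?thesis
  proof (rule that[of h])
    have "poly (pderiv (char_poly (W 1))) (\<alpha> r) \<noteq> 0" if r: "r < g" for r
    proof -
      define q where "q = (\<Prod>i\<in>{..<g} - {r}. [:- \<alpha> i, 1:])"
      have "char_poly (W 1) = [:- \<alpha> r, 1:] * q"
        unfolding W1 char_poly_mat_diag q_def using r by (subst prod.remove[of _ r]) auto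
      hence "pderiv (char_poly (W 1)) = [:- \<alpha> r, 1:] * pderiv q + q * pderiv [:- \<alpha> r, 1:]"
        by (metis pderiv_mult)
      hence "poly (pderiv (char_poly (W 1))) (\<alpha> r) = poly q (\<alpha> r)" by (simp add: pderiv_pCons)
      also have "\<dots> \<noteq> 0"
        using inj r by (auto simp: q_def poly_prod prod_zero_iff inj_on_def)
      finally show ?thesis .
    qed
    hence "(\<Prod>r<g. poly (pderiv (char_poly (W 1))) (\<alpha> r)) \<noteq> 0" by (auto simp: prod_zero_iff)
    moreover have "H 1 = mat_diag g (\<lambda>r. poly (pderiv (char_poly (W 1))) (\<alpha> r))"
      unfolding pd unfolding H_def W1 mat_poly_diag ..
    ultimately show "poly h 1 \<noteq> 0" by (simp add: fun_cong[OF h, symmetric] det_mat_diag)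
  next
    fix t a assume ht: "poly h t \<noteq> 0"
    show "\<not> (poly (char_poly (W t)) a = 0 \<and> poly (pderiv (char_poly (W t))) a = 0)"
    proof
      assume a: "poly (char_poly (W t)) a = 0 \<and> poly (pderiv (char_poly (W t))) a = 0"
      \<comment> \<open>The matrix \<open>H t\<close> is the derivative of the characteristic
        polynomial evaluated at \<open>W t\<close>. It multiplies an eigenvector for
        \<open>a\<close> by the value of that derivative at \<open>a\<close>, so a multiple root
        makes it singular.\<close>
      then obtain v where v: "v \<in> carrier_vec g" "v \<noteq> 0\<^sub>v g" "W t *\<^sub>v v = a \<cdot>\<^sub>v v"
        using Wc[of t] unfolding eigenvalue_root_char_poly[OF Wc, symmetric]
        by (auto simp: eigenvalue_def eigenvector_def)
      have "H t *\<^sub>v v = 0 \<cdot>\<^sub>v v"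
        unfolding H_def mat_poly_eigenvector[OF Wc v(1,3)] pd[symmetric] using a by simp
      hence "H t *\<^sub>v v = 0\<^sub>v g" using v(1) by (auto intro!: eq_vecI)
      hence "det (H t) = 0" using det_0_iff_vec_prod_zero[OF H[of t]] v by blast
      thus False using ht fun_cong[OF h, of t] by simp
    qed
  qed
qed

section \<open>Lines in the space of symmetric tuples\<close>

definition tuple_line :: "nat \<Rightarrow> (nat \<Rightarrow> 'k::field mat) \<Rightarrow> (nat \<Rightarrow> 'k mat) \<Rightarrow> 'k \<Rightarrow> nat \<Rightarrow> 'k mat" where
  "tuple_line n Q Q' t = (\<lambda>k\<in>{..n}. (1 - t) \<cdot>\<^sub>m Q k + t \<cdot>\<^sub>m Q' k)"

lemma tuple_line_in_sym_tuples:
  assumes "Q \<in> sym_tuples g n" "Q' \<in> sym_tuples g n"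
  shows "tuple_line n Q Q' t \<in> sym_tuples g n"
proof -
  have "(1 - t) \<cdot>\<^sub>m Q k + t \<cdot>\<^sub>m Q' k \<in> sym_mats g" if "k \<le> n" for k
  proof -
    have Q: "Q k \<in> carrier_mat g g" "Q' k \<in> carrier_mat g g" "transpose_mat (Q k) = Q k"
      "transpose_mat (Q' k) = Q' k"
      using assms that by (auto simp: sym_tuples_def sym_mats_def PiE_iff)
    have "Q k $$ (j, i) = Q k $$ (i, j)" "Q' k $$ (j, i) = Q' k $$ (i, j)" if "i < g" "j < g" for i j
      using that Q by (metis carrier_matD index_transpose_mat(1))+
    thus ?thesis using Q(1,2) by (auto simp: sym_mats_def intro!: eq_matI)
  qed
  thus ?thesis by (auto simp: tuple_line_def sym_tuples_def)
qed

lemma tuple_line_matrix_function: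
  assumes "Q \<in> sym_tuples g n" "Q' \<in> sym_tuples g n" "k \<le> n"
  shows "univariate.matrix_function g (\<lambda>t. tuple_line n Q Q' t k)"
proof (rule univariate.matrix_functionI)
  have Q: "Q k \<in> carrier_mat g g" "Q' k \<in> carrier_mat g g"
    using assms by (auto simp: sym_tuples_def sym_mats_def PiE_iff)
  show "tuple_line n Q Q' t k \<in> carrier_mat g g" for t
    using Q assms(3) by (simp add: tuple_line_def)
  fix i j assume ij: "i < g" "j < g"
  have "(\<lambda>t. tuple_line n Q Q' t k $$ (i, j)) = poly [:Q k $$ (i, j), Q' k $$ (i, j) - Q k $$ (i, j):]"
    using Q ij assms(3) by (auto simp: tuple_line_def algebra_simps)
  thus "(\<lambda>t. tuple_line n Q Q' t k $$ (i, j)) \<in> range poly" by (metis rangeI)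
qed

lemma pi_map_matrix_function:
  assumes "function_algebra T R"
    and "\<And>k. k \<le> n \<Longrightarrow> function_algebra.matrix_function T R g (\<lambda>s. Q s k)" and k: "k < n"
  shows "function_algebra.matrix_function T R g (\<lambda>s. pi_map n (Q s) k)"
proof -
  interpret function_algebra T R by fact
  have "matrix_function g (\<lambda>s. Q s k * adj_mat (Q s (Suc k)))"
    using k by (intro matrix_function_mult matrix_function_adj assms(2)) auto
  thus ?thesis using k by (simp add: pi_map_def)
qed

lemma mat_invariants_subset: "carrier (mat_invariants g n) \<subseteq> carrier (coordinate_ring g {..<n} (mat_tuples g n))"
  by (auto simp: mat_invariants_def)

lemma coordinate_ring_pi_map:
  assumes f: "f \<in> carrier (coordinate_ring g {..<n} (mat_tuples g n))" and R: "function_algebra T R"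
    and Q: "\<And>s. s \<in> T \<Longrightarrow> Q s \<in> sym_tuples g n"
    and entries: "\<And>k. k \<le> n \<Longrightarrow> function_algebra.matrix_function T R g (\<lambda>s. Q s k)"
  shows "(\<lambda>s. f (pi_map n (Q s))) \<in> R"
proof (rule coordinate_ring_subst[OF f R])
  show "pi_map n (Q s) \<in> mat_tuples g n" if "s \<in> T" for s by (rule pi_map_in_mat_tuples[OF Q[OF that]])
  show "(\<lambda>s. pi_map n (Q s) k $$ (i, j)) \<in> R" if "k \<in> {..<n}" "i < g" "j < g" for k i j
    using function_algebra.matrix_functionD(2)[OF R pi_map_matrix_function[OF R entries]] that by auto
qed

text \<open>Every \<open>Q\<close> is joined by a line to a tuple \<open>Q'\<close> that satisfies
  the open conditions of \<open>slice_reaches\<close>. These fail at only finitely many parameters,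
  elsewhere \<open>\<Phi>\<close> takes a value from the slice, and a polynomial with infinitely
  many zeros vanishes at the end \<open>Q\<close> too.\<close>

lemma vanishing_on_slice:
  fixes \<Phi> :: "(nat \<Rightarrow> 'k::alg_closed_field mat) \<Rightarrow> 'k"
  assumes g: "g \<ge> 1" and n: "n \<ge> 1"
    and line: "\<And>Q Q'. Q \<in> sym_tuples g n \<Longrightarrow> Q' \<in> sym_tuples g n \<Longrightarrow> (\<lambda>t. \<Phi> (tuple_line n Q Q' t)) \<in> range poly"
    and inv: "\<And>Q Q'. Q \<in> sym_tuples g n \<Longrightarrow> Q' \<in> sym_tuples g n \<Longrightarrow>
        (\<And>f. f \<in> carrier (mat_invariants g n) \<Longrightarrow> f (pi_map n Q) = f (pi_map n Q')) \<Longrightarrow> \<Phi> Q = \<Phi> Q'"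
    and slice: "\<And>\<tau>. \<Phi> (slice g n \<tau>) = 0"
    and Q: "Q \<in> sym_tuples g n"
  shows "\<Phi> Q = 0"
proof -
  obtain \<alpha> :: "nat \<Rightarrow> 'k" where \<alpha>: "inj \<alpha>" "range \<alpha> \<subseteq> UNIV - {0}"
    using infinite_countable_subset[of "UNIV - {0 :: 'k}"] infinite_alg_closed_field by auto
  \<comment> \<open>Here the last component of \<open>pi_map\<close> is
    \<open>mat_diag g \<alpha>\<close>, with distinct eigenvalues, and all determinants are nonzero
    as no \<open>\<alpha> i\<close> is 0.\<close>
  define Q' where "Q' = (\<lambda>k\<in>{..n}. if Suc k = n then mat_diag g \<alpha> else 1\<^sub>m g)"
  have Q': "Q' \<in> sym_tuples g n"
    by (auto simp: Q'_def sym_tuples_def sym_mats_def mat_diag_transpose)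
  let ?L = "tuple_line n Q Q'"
  have L: "?L t \<in> sym_tuples g n" for t by (rule tuple_line_in_sym_tuples[OF Q Q'])
  have Lm: "univariate.matrix_function g (\<lambda>t. ?L t k)" if "k \<le> n" for k
    by (rule tuple_line_matrix_function[OF Q Q' that])
  have L0: "?L 0 = Q" and L1: "?L 1 = Q'"
  proof -
    have c: "Q k \<in> carrier_mat g g" "Q' k \<in> carrier_mat g g" if "k \<le> n" for k
      using Q Q' that by (auto simp: sym_tuples_def sym_mats_def PiE_iff)
    have "?L 0 k = Q k \<and> ?L 1 k = Q' k" for k
    proof (cases "k \<le> n")
      case True
      show ?thesis using c[OF True] True by (auto simp: tuple_line_def intro!: eq_matI)
    next
      case False
      thus ?thesis using Q Q' by (auto simp: tuple_line_def sym_tuples_def PiE_def extensional_def)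
    qed
    thus "?L 0 = Q" "?L 1 = Q'" by auto
  qed
  have "univariate.matrix_function g (\<lambda>t. pi_map n (?L t) (n - 1))"
    using n by (intro pi_map_matrix_function Lm univariate.function_algebra_axioms) auto
  moreover have "pi_map n (?L 1) (n - 1) = mat_diag g \<alpha>"
    using n by (simp add: L1 pi_map_def) (simp add: Q'_def adj_mat_one right_mult_one_mat[of _ g g])
  ultimately obtain h where h: "poly h 1 \<noteq> 0" "\<And>t a. poly h t \<noteq> 0 \<Longrightarrow>
      \<not> (poly (char_poly (pi_map n (?L t) (n - 1))) a = 0 \<and>
         poly (pderiv (char_poly (pi_map n (?L t) (n - 1)))) a = 0)"
    using squarefree_char_poly_generic[OF _ g, of "\<lambda>t. pi_map n (?L t) (n - 1)" \<alpha>] \<alpha>(1)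
    by (metis inj_on_subset subset_UNIV)
  have "(\<lambda>t. \<Prod>k\<le>n. det (?L t k)) \<in> range poly"
    by (intro univariate.prod_closed univariate.det_closed[OF Lm]) auto
  then obtain d where d: "(\<lambda>t. \<Prod>k\<le>n. det (?L t k)) = poly d" by auto
  have "det (Q' k) \<noteq> 0" if "k \<le> n" for k
    using that \<alpha>(2) by (auto simp: Q'_def det_mat_diag prod_zero_iff)
  hence d1: "poly d 1 \<noteq> 0" by (auto simp: fun_cong[OF d, symmetric] L1 prod_zero_iff)
  from line[OF Q Q'] obtain p where p: "(\<lambda>t. \<Phi> (?L t)) = poly p" by auto
  \<comment> \<open>Multiplying by \<open>d\<close> and \<open>h\<close> absorbs the bad parameters,
    so the identity holds for all \<open>t\<close> and \<open>p\<close> can be cancelled out as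
    zero.\<close>
  have "poly (p * (d * h)) t = 0" for t
  proof (cases "poly d t = 0 \<or> poly h t = 0")
    case False
    hence dets: "det (?L t k) \<noteq> 0" if "k \<le> n" for k
      using that by (auto simp: fun_cong[OF d, symmetric] prod_zero_iff)
    obtain \<tau> where \<tau>: "\<And>f. f \<in> carrier (mat_invariants g n) \<Longrightarrow> f (pi_map n (?L t)) = f (pi_map n (slice g n \<tau>))"
      using slice_reaches[OF g n L dets h(2)] False by blast
    have "\<Phi> (?L t) = \<Phi> (slice g n \<tau>)" by (rule inv[OF L slice_in_sym_tuples \<tau>])
    hence "\<Phi> (?L t) = 0" using slice by simp
    thus ?thesis using fun_cong[OF p, of t] by simp
  qed auto
  hence "p * (d * h) = 0"
    using poly_roots_finite[of "p * (d * h)"] infinite_alg_closed_field by auto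
  moreover have "d \<noteq> 0" "h \<noteq> 0" using d1 h(1) by auto
  ultimately have "p = 0" by simp
  thus ?thesis using fun_cong[OF p, of 0] L0 by simp
qed

section \<open>Krull dimension of rings of functions\<close>

context function_algebra
begin

abbreviation function_ring :: "('s \<Rightarrow> 'k) ring" where
  "function_ring \<equiv> (fun_ring T)\<lparr>carrier := (\<lambda>F. restrict F T) ` R\<rparr>"

lemma restrict_in_image_iff: "restrict F T \<in> (\<lambda>F. restrict F T) ` R \<longleftrightarrow> F \<in> R"
proof
  assume "restrict F T \<in> (\<lambda>F. restrict F T) ` R"
  then obtain G where G: "G \<in> R" "restrict F T = restrict G T" by blast
  show "F \<in> R"
  proof (rule cong_closed[OF G(1)])
    fix s assume "s \<in> T"
    thus "F s = G s" using fun_cong[OF G(2), of s] by simp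
  qed
qed blast

lemma function_ring_cring: "cring function_ring"
proof -
  interpret X: cring "fun_ring T :: ('s \<Rightarrow> 'k) ring" by (rule fun_ring_cring)
  have sub: "(\<lambda>F. restrict F T) ` R \<subseteq> carrier (fun_ring T)" by (auto simp: fun_ring_simps)
  have "subring ((\<lambda>F. restrict F T) ` R) (fun_ring T)"
  proof (rule X.subringI[OF sub])
    show "\<one>\<^bsub>fun_ring T\<^esub> \<in> (\<lambda>F. restrict F T) ` R"
      unfolding fun_ring_simps restrict_in_image_iff by (rule const_closed)
  next
    fix h assume "h \<in> (\<lambda>F. restrict F T) ` R"
    then obtain F where F: "F \<in> R" "h = restrict F T" by blast
    have "\<ominus>\<^bsub>fun_ring T\<^esub> h = restrict (\<lambda>s. - F s) T"
      unfolding F(2) by (subst fun_ring_a_inv) (auto intro!: ext)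
    thus "\<ominus>\<^bsub>fun_ring T\<^esub> h \<in> (\<lambda>F. restrict F T) ` R"
      by (simp only: restrict_in_image_iff uminus_closed[OF F(1)])
  next
    fix h1 h2 assume "h1 \<in> (\<lambda>F. restrict F T) ` R" "h2 \<in> (\<lambda>F. restrict F T) ` R"
    then obtain F G where F: "F \<in> R" "h1 = restrict F T" and G: "G \<in> R" "h2 = restrict G T" by blast
    have "h1 \<otimes>\<^bsub>fun_ring T\<^esub> h2 = restrict (\<lambda>s. F s * G s) T"
      "h1 \<oplus>\<^bsub>fun_ring T\<^esub> h2 = restrict (\<lambda>s. F s + G s) T"
      by (auto simp: fun_ring_simps F G intro!: ext)
    thus "h1 \<otimes>\<^bsub>fun_ring T\<^esub> h2 \<in> (\<lambda>F. restrict F T) ` R" "h1 \<oplus>\<^bsub>fun_ring T\<^esub> h2 \<in> (\<lambda>F. restrict F T) ` R"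
      by (simp_all only: restrict_in_image_iff mult_closed[OF F(1) G(1)] add_closed[OF F(1) G(1)])
  qed
  hence "subcring ((\<lambda>F. restrict F T) ` R) (fun_ring T)" by (rule X.subcringI')
  thus ?thesis using X.subcring_iff[OF sub] by blast
qed

lemma primeideal_imp_prime_in:
  assumes "primeideal I function_ring"
  shows "prime_in {F. restrict F T \<in> I}"
proof -
  interpret primeideal I function_ring by fact
  have sub: "I \<subseteq> (\<lambda>F. restrict F T) ` R" using a_subset by simp
  have mult: "restrict F T \<otimes>\<^bsub>function_ring\<^esub> restrict G T = restrict (\<lambda>s. F s * G s) T"
    and add: "restrict F T \<oplus>\<^bsub>function_ring\<^esub> restrict G T = restrict (\<lambda>s. F s + G s) T" for F G :: "'s \<Rightarrow> 'k"
    by (auto simp: fun_ring_simps intro!: ext)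
  show ?thesis
    unfolding prime_in_def
  proof (intro conjI ballI impI subsetI)
    fix F assume "F \<in> {F. restrict F T \<in> I}"
    thus "F \<in> R" using sub restrict_in_image_iff by blast
  next
    show "(\<lambda>_. 1) \<notin> {F. restrict F T \<in> I}"
    proof
      assume "(\<lambda>_. 1) \<in> {F. restrict F T \<in> I}"
      hence "\<one>\<^bsub>function_ring\<^esub> \<in> I" by (simp add: fun_ring_simps)
      hence "I = carrier function_ring" by (rule one_imp_carrier)
      thus False using I_notcarr by simp
    qed
  next
    fix F G assume "F \<in> {F. restrict F T \<in> I}" "G \<in> {F. restrict F T \<in> I}"
    thus "(\<lambda>s. F s + G s) \<in> {F. restrict F T \<in> I}"
      using additive_subgroup.a_closed[OF additive_subgroup_axioms, of "restrict F T" "restrict G T"] by (simp only: mem_Collect_eq add)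
  next
    fix F G assume "F \<in> R" "G \<in> {F. restrict F T \<in> I}"
    thus "(\<lambda>s. F s * G s) \<in> {F. restrict F T \<in> I}"
      using I_l_closed[of "restrict G T" "restrict F T"] restrict_in_image_iff[of F]
      by (simp only: mem_Collect_eq mult) simp
  next
    fix F G assume "F \<in> R" "G \<in> R" "(\<lambda>s. F s * G s) \<in> {F. restrict F T \<in> I}"
    thus "F \<in> {F. restrict F T \<in> I} \<or> G \<in> {F. restrict F T \<in> I}"
      using I_prime[of "restrict F T" "restrict G T"] restrict_in_image_iff[of F] restrict_in_image_iff[of G]
      by (simp only: mem_Collect_eq mult) simp
  qed
qed

text \<open>By \<open>zero\<close>, membership in \<open>P\<close> depends only on the values on
  \<open>T\<close>, so restricting does not merge members with non-members.\<close>

lemma prime_in_imp_primeideal: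
  assumes P: "prime_in P" and zero: "\<And>F. (\<And>s. s \<in> T \<Longrightarrow> F s = 0) \<Longrightarrow> F \<in> P"
  shows "primeideal ((\<lambda>F. restrict F T) ` P) function_ring"
proof -
  interpret cring function_ring by (rule function_ring_cring)
  have mult: "restrict F T \<otimes>\<^bsub>function_ring\<^esub> restrict G T = restrict (\<lambda>s. F s * G s) T"
    and add: "restrict F T \<oplus>\<^bsub>function_ring\<^esub> restrict G T = restrict (\<lambda>s. F s + G s) T" for F G :: "'s \<Rightarrow> 'k"
    by (auto simp: fun_ring_simps intro!: ext)
  have PR: "P \<subseteq> R" using prime_inD(1)[OF P] by blast
  have cong: "G \<in> P" if F: "F \<in> P" and eq: "restrict G T = restrict F T" for F G
  proof -
    have FG: "F s = G s" if "s \<in> T" for s using fun_cong[OF eq, of s] that by simp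
    have "(\<lambda>s. F s + (G s - F s)) \<in> P" by (intro prime_inD(3)[OF P] F zero) (simp add: FG)
    thus ?thesis by simp
  qed
  have mem: "restrict F T \<in> (\<lambda>F. restrict F T) ` P \<longleftrightarrow> F \<in> P" for F using cong by blast
  show ?thesis
  proof (rule primeidealI[OF idealI])
    show "ring function_ring" by (rule ring_axioms)
    show "cring function_ring" by (rule is_cring)
    show "subgroup ((\<lambda>F. restrict F T) ` P) (add_monoid function_ring)"
    proof (rule subgroup.intro, goal_cases)
      case 1
      show ?case using PR by auto
    next
      case (2 x y)
      then obtain F G where FG: "F \<in> P" "G \<in> P" "x = restrict F T" "y = restrict G T" by blast
      have "restrict (\<lambda>s. F s + G s) T \<in> (\<lambda>F. restrict F T) ` P"
        unfolding mem by (rule prime_inD(3)[OF P FG(1,2)])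
      thus ?case using add[of F G] by (simp add: FG(3,4))
    next
      case 3
      have "restrict (\<lambda>_. 0) T \<in> (\<lambda>F. restrict F T) ` P" unfolding mem by (rule zero) simp
      thus ?case by (simp add: fun_ring_simps)
    next
      case (4 x)
      then obtain F where F: "F \<in> P" "x = restrict F T" by blast
      have FR: "F \<in> R" using F(1) PR by blast
      have nP: "(\<lambda>s. -1 * F s) \<in> P" by (rule prime_inD(4)[OF P const_closed F(1)])
      have "restrict (\<lambda>s. -1 * F s) T \<oplus>\<^bsub>function_ring\<^esub> restrict F T = \<zero>\<^bsub>function_ring\<^esub>"
        by (auto simp: fun_ring_simps intro!: ext)
      hence "\<ominus>\<^bsub>function_ring\<^esub> x = restrict (\<lambda>s. -1 * F s) T"
        using F nP PR FR by (intro minus_equality) auto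
      thus ?case using nP unfolding a_inv_def by (metis imageI)
    qed
  next
    fix a x assume "a \<in> (\<lambda>F. restrict F T) ` P" "x \<in> carrier function_ring"
    then obtain F G where FG: "F \<in> P" "G \<in> R" "a = restrict F T" "x = restrict G T" by auto
    have GF: "restrict (\<lambda>s. G s * F s) T \<in> (\<lambda>F. restrict F T) ` P"
      unfolding mem by (rule prime_inD(4)[OF P FG(2,1)])
    thus "x \<otimes>\<^bsub>function_ring\<^esub> a \<in> (\<lambda>F. restrict F T) ` P" unfolding FG(3,4) mult .
    show "a \<otimes>\<^bsub>function_ring\<^esub> x \<in> (\<lambda>F. restrict F T) ` P"
      unfolding FG(3,4) mult using GF by (simp only: mult.commute)
  next
    have "restrict (\<lambda>_. 1) T \<notin> (\<lambda>F. restrict F T) ` P" unfolding mem by (rule prime_inD(2)[OF P])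
    moreover have "restrict (\<lambda>_. 1) T \<in> carrier function_ring" using const_closed by simp
    ultimately show "carrier function_ring \<noteq> (\<lambda>F. restrict F T) ` P" by blast
  next
    fix a b assume ab: "a \<in> carrier function_ring" "b \<in> carrier function_ring"
      and prod: "a \<otimes>\<^bsub>function_ring\<^esub> b \<in> (\<lambda>F. restrict F T) ` P"
    from ab obtain F G where FG: "F \<in> R" "G \<in> R" "a = restrict F T" "b = restrict G T" by auto
    from prod have "(\<lambda>s. F s * G s) \<in> P" unfolding FG(3,4) mult mem .
    hence "F \<in> P \<or> G \<in> P" by (rule prime_inD(5)[OF P _ FG(1,2)])
    thus "a \<in> (\<lambda>F. restrict F T) ` P \<or> b \<in> (\<lambda>F. restrict F T) ` P" unfolding FG(3,4) mem .
  qed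
qed

text \<open>Elements chosen from the successive differences of a prime chain are independent modulo
  its bottom ideal. A relation valid on \<open>T\<close> is zero in the ring and thus lies in that
  ideal.\<close>

lemma krull_dim_le:
  assumes dep: "\<And>k x. k > d \<Longrightarrow> (\<And>i. i < k \<Longrightarrow> x i \<in> R) \<Longrightarrow> \<exists>E c e. finite E \<and> (\<forall>e\<in>E. length e = k) \<and>
      e \<in> E \<and> c e \<noteq> 0 \<and> (\<forall>s\<in>T. (\<Sum>e\<in>E. c e * monomial x e s) = 0)"
  shows "krull_dim function_ring \<le> enat d"
  unfolding krull_dim_def
proof (rule Sup_least)
  fix l assume "l \<in> {enat k | k. \<exists>P. (\<forall>i\<le>k. primeideal (P i) function_ring) \<and> (\<forall>i<k. P i \<subset> P (Suc i))}"
  then obtain k P where l: "l = enat k" and prime: "\<And>i. i \<le> k \<Longrightarrow> primeideal (P i) function_ring"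
    and chain: "\<And>i. i < k \<Longrightarrow> P i \<subset> P (Suc i)" by blast
  show "l \<le> enat d"
  proof (rule ccontr)
    assume "\<not> l \<le> enat d"
    hence k: "k > d" by (simp add: l)
    define Q where "Q i = {F. restrict F T \<in> P i}" for i
    have Q: "prime_in (Q i)" if "i \<le> k" for i
      unfolding Q_def by (rule primeideal_imp_prime_in[OF prime[OF that]])
    have "\<exists>F. F \<in> Q (Suc i) - Q i" if i: "i < k" for i
    proof -
      obtain p where p: "p \<in> P (Suc i)" "p \<notin> P i" using chain[OF i] by blast
      interpret primeideal "P (Suc i)" function_ring using prime[of "Suc i"] i by simp
      obtain F where "p = restrict F T" using a_subset p(1) by auto
      thus ?thesis using p by (auto simp: Q_def)
    qed
    then obtain x where x: "\<And>i. i < k \<Longrightarrow> x i \<in> Q (Suc i) - Q i" by metis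
    have "x i \<in> R" if "i < k" for i using x[OF that] prime_inD(1)[OF Q[of "Suc i"]] that by auto
    then obtain E c e where E: "finite E" "\<And>e. e \<in> E \<Longrightarrow> length e = k" "e \<in> E" "c e \<noteq> 0"
      "\<And>s. s \<in> T \<Longrightarrow> (\<Sum>e\<in>E. c e * monomial x e s) = 0" using dep[OF k, of x] by blast
    interpret P0: primeideal "P 0" function_ring using prime[of 0] by simp
    have "restrict (\<lambda>s. \<Sum>e\<in>E. c e * monomial x e s) T = \<zero>\<^bsub>function_ring\<^esub>"
      using E(5) by (auto simp: fun_ring_simps intro!: ext)
    hence "(\<lambda>s. \<Sum>e\<in>E. c e * monomial x e s) \<in> Q 0"
      using P0.additive_subgroup_axioms additive_subgroup.zero_closed by (fastforce simp: Q_def)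
    from prime_chain_independent[of k Q x E c, OF Q _ x E(1,2) this E(3)] chain
    have "c e = 0" by (auto simp: Q_def)
    thus False using E(4) by simp
  qed
qed

text \<open>The ideals consist of the functions that vanish on \<open>Z i\<close>, so shrinking sets
  give growing ideals. The assumption \<open>irr\<close> is primality, that is, irreducibility of
  \<open>Z i\<close>, and \<open>sep\<close> makes the inclusions strict.\<close>

lemma krull_dim_ge:
  assumes sub: "\<And>i. i < d \<Longrightarrow> Z (Suc i) \<subseteq> Z i" and ne: "Z d \<noteq> {}" and ZT: "Z 0 \<subseteq> T"
    and irr: "\<And>i F G. i \<le> d \<Longrightarrow> F \<in> R \<Longrightarrow> G \<in> R \<Longrightarrow> (\<forall>s\<in>Z i. F s * G s = 0) \<Longrightarrow>
       (\<forall>s\<in>Z i. F s = 0) \<or> (\<forall>s\<in>Z i. G s = 0)"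
    and sep: "\<And>i. i < d \<Longrightarrow> \<exists>F\<in>R. (\<forall>s\<in>Z (Suc i). F s = 0) \<and> (\<exists>s\<in>Z i. F s \<noteq> 0)"
  shows "enat d \<le> krull_dim function_ring"
proof -
  define P where "P i = {F \<in> R. \<forall>s\<in>Z i. F s = 0}" for i
  have Zd: "Z d \<subseteq> Z i" if "i \<le> d" for i
    using that by (induction rule: inc_induct) (use sub in auto)
  have Z0: "Z i \<subseteq> T" if "i \<le> d" for i
    using that
  proof (induction i)
    case (Suc i)
    thus ?case using sub[of i] by auto
  qed (rule ZT)
  have prime: "prime_in (P i)" if i: "i \<le> d" for i
    unfolding prime_in_def
  proof (intro conjI ballI impI)
    obtain s where "s \<in> Z i" using Zd[OF i] ne by blast
    thus "(\<lambda>_. 1) \<notin> P i" by (auto simp: P_def)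
    fix F G assume F: "F \<in> R" and G: "G \<in> R"
    show "F \<in> P i \<or> G \<in> P i" if "(\<lambda>s. F s * G s) \<in> P i"
      using irr[OF i F G] that F G by (simp add: P_def)
  qed (auto simp: P_def intro: add_closed mult_closed)
  have zero: "F \<in> P i" if "i \<le> d" "\<And>s. s \<in> T \<Longrightarrow> F s = 0" for i F
    using Z0[OF that(1)] that(2) cong_closed[OF const_closed[of 0], of F] by (auto simp: P_def)
  have "primeideal ((\<lambda>F. restrict F T) ` P i) function_ring" if "i \<le> d" for i
    using that by (intro prime_in_imp_primeideal prime zero) auto
  moreover have "(\<lambda>F. restrict F T) ` P i \<subset> (\<lambda>F. restrict F T) ` P (Suc i)" if i: "i < d" for i
  proof -
    have "(\<lambda>F. restrict F T) ` P i \<subseteq> (\<lambda>F. restrict F T) ` P (Suc i)"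
      using sub[OF i] by (intro image_mono) (auto simp: P_def)
    moreover obtain F s where F: "F \<in> R" "\<forall>s\<in>Z (Suc i). F s = 0" "s \<in> Z i" "F s \<noteq> 0"
      using sep[OF i] by blast
    have "restrict F T \<in> (\<lambda>F. restrict F T) ` P (Suc i)" using F by (auto simp: P_def)
    moreover have "restrict F T \<notin> (\<lambda>F. restrict F T) ` P i"
    proof
      assume "restrict F T \<in> (\<lambda>F. restrict F T) ` P i"
      then obtain G where G: "G \<in> P i" "restrict F T = restrict G T" by blast
      have "s \<in> T" using F(3) Z0[of i] i by auto
      hence "F s = G s" using fun_cong[OF G(2), of s] by simp
      thus False using G(1) F(3,4) by (simp add: P_def)
    qed
    ultimately show ?thesis by blast
  qed
  ultimately have "\<exists>P. (\<forall>i\<le>d. primeideal (P i) function_ring) \<and> (\<forall>i<d. P i \<subset> P (Suc i))"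
    by (intro exI[of _ "\<lambda>i. (\<lambda>F. restrict F T) ` P i"]) simp
  thus ?thesis unfolding krull_dim_def by (intro Sup_upper CollectI exI[of _ d] conjI refl)
qed

end

section \<open>Invariants of tuples of matrices\<close>

abbreviation mat_functions :: "nat \<Rightarrow> nat \<Rightarrow> ((nat \<Rightarrow> 'k::field mat) \<Rightarrow> 'k) set" where
  "mat_functions g n \<equiv> {F. restrict F (mat_tuples g n) \<in> carrier (coordinate_ring g {..<n} (mat_tuples g n))}"

interpretation mat_functions: function_algebra "mat_tuples g n" "mat_functions g n"
  for g n by (rule coordinate_ring_function_algebra)

lemma conj_act_SL:
  fixes L :: "'k::field mat"
  assumes "L \<in> SL_mats g"
  obtains L' where "L' \<in> carrier_mat g g" "L * L' = 1\<^sub>m g" "L' * L = 1\<^sub>m g"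
    "\<And>n M. conj_act n L M = (\<lambda>k\<in>{..<n}. L * M k * L')"
proof -
  have L: "L \<in> carrier_mat g g" "det L \<noteq> 0" using assms by (auto simp: SL_mats_def)
  from inverse_matE[OF this] obtain L' where L': "L' \<in> carrier_mat g g" "L * L' = 1\<^sub>m g" "L' * L = 1\<^sub>m g" .
  show ?thesis
    by (rule that[OF L']) (simp add: conj_act_def mat_inverse_eq[OF L(1) L'(1,2)])
qed

lemma conj_in_mat_tuples:
  assumes "L \<in> carrier_mat g g" "L' \<in> carrier_mat g g" "M \<in> mat_tuples g n"
  shows "(\<lambda>k\<in>{..<n}. L * M k * L') \<in> mat_tuples g n"
  using assms by (auto simp: mat_tuples_def PiE_iff intro!: mult_carrier_mat)

lemma mat_invariants_iff:
  fixes F :: "(nat \<Rightarrow> 'k::field mat) \<Rightarrow> 'k"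
  shows "restrict F (mat_tuples g n) \<in> carrier (mat_invariants g n) \<longleftrightarrow> F \<in> mat_functions g n \<and>
    (\<forall>L\<in>SL_mats g. \<forall>M\<in>mat_tuples g n. F (conj_act n L M) = F M)"
proof -
  have "conj_act n L M \<in> mat_tuples g n" if "L \<in> SL_mats g" "M \<in> mat_tuples g n" for L :: "'k mat" and M
  proof -
    from conj_act_SL[OF that(1)] obtain L' where L': "L' \<in> carrier_mat g g"
      "conj_act n L M = (\<lambda>k\<in>{..<n}. L * M k * L')" by metis
    show ?thesis unfolding L'(2)
      using that L'(1) by (intro conj_in_mat_tuples) (auto simp: SL_mats_def)
  qed
  thus ?thesis by (auto simp: mat_invariants_def)
qed

lemma mat_invariants_function_algebra:
  "function_algebra (mat_tuples g n)
     {F. restrict F (mat_tuples g n) \<in> carrier (mat_invariants g n :: ((nat \<Rightarrow> 'k::field mat) \<Rightarrow> 'k) ring)}"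
proof
  fix F G :: "(nat \<Rightarrow> 'k mat) \<Rightarrow> 'k"
  assume "F \<in> {F. restrict F (mat_tuples g n) \<in> carrier (mat_invariants g n)}"
    "G \<in> {F. restrict F (mat_tuples g n) \<in> carrier (mat_invariants g n)}"
  thus "(\<lambda>s. F s + G s) \<in> {F. restrict F (mat_tuples g n) \<in> carrier (mat_invariants g n)}"
    "(\<lambda>s. F s * G s) \<in> {F. restrict F (mat_tuples g n) \<in> carrier (mat_invariants g n)}"
    using mat_functions.add_closed[of F g n G] mat_functions.mult_closed[of F g n G]
    unfolding mem_Collect_eq mat_invariants_iff by auto
next
  fix F G :: "(nat \<Rightarrow> 'k mat) \<Rightarrow> 'k"
  assume F: "F \<in> {F. restrict F (mat_tuples g n) \<in> carrier (mat_invariants g n)}"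
    and "\<And>s. s \<in> mat_tuples g n \<Longrightarrow> G s = F s"
  hence "restrict G (mat_tuples g n) = restrict F (mat_tuples g n)" by auto
  thus "G \<in> {F. restrict F (mat_tuples g n) \<in> carrier (mat_invariants g n)}" using F by simp
next
  fix c :: 'k
  show "(\<lambda>_. c) \<in> {F. restrict F (mat_tuples g n) \<in> carrier (mat_invariants g n)}"
    using mat_functions.const_closed[of c g n] unfolding mem_Collect_eq mat_invariants_iff by auto
qed

lemma function_algebra_pullback:
  assumes "function_algebra X R" and \<phi>: "\<And>s. s \<in> T \<Longrightarrow> \<phi> s \<in> X"
  shows "function_algebra T {F. \<exists>f\<in>R. \<forall>s\<in>T. F s = f (\<phi> s)}"
proof -
  interpret function_algebra X R by fact
  show ?thesis
  proof
    fix F G assume "F \<in> {F. \<exists>f\<in>R. \<forall>s\<in>T. F s = f (\<phi> s)}" "G \<in> {F. \<exists>f\<in>R. \<forall>s\<in>T. F s = f (\<phi> s)}"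
    then obtain f h where fh: "f \<in> R" "h \<in> R" "\<forall>s\<in>T. F s = f (\<phi> s)" "\<forall>s\<in>T. G s = h (\<phi> s)" by blast
    show "(\<lambda>s. F s + G s) \<in> {F. \<exists>f\<in>R. \<forall>s\<in>T. F s = f (\<phi> s)}"
      using add_closed[OF fh(1,2)] fh(3,4) by (auto intro!: bexI[of _ "\<lambda>x. f x + h x"])
    show "(\<lambda>s. F s * G s) \<in> {F. \<exists>f\<in>R. \<forall>s\<in>T. F s = f (\<phi> s)}"
      using mult_closed[OF fh(1,2)] fh(3,4) by (auto intro!: bexI[of _ "\<lambda>x. f x * h x"])
  next
    fix c show "(\<lambda>_. c) \<in> {F. \<exists>f\<in>R. \<forall>s\<in>T. F s = f (\<phi> s)}"
      using const_closed[of c] by (auto intro!: bexI[of _ "\<lambda>_. c"])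
  qed auto
qed

text \<open>The source of all explicit invariants: determinants and traces of such maps. Inverses
  appear as pairs \<open>L\<close>, \<open>L'\<close>, which keeps \<open>mat_inverse\<close> out of
  the calculations.\<close>

definition equivariant :: "nat \<Rightarrow> nat \<Rightarrow> ((nat \<Rightarrow> 'k::field mat) \<Rightarrow> 'k mat) \<Rightarrow> bool" where
  "equivariant g n W \<longleftrightarrow> mat_functions.matrix_function g n g W \<and>
     (\<forall>L\<in>carrier_mat g g. \<forall>L'\<in>carrier_mat g g. \<forall>M\<in>mat_tuples g n. L * L' = 1\<^sub>m g \<longrightarrow> L' * L = 1\<^sub>m g \<longrightarrow>
        W (\<lambda>k\<in>{..<n}. L * M k * L') = L * W M * L')"

lemma equivariantD:
  assumes "equivariant g n W"
  shows "mat_functions.matrix_function g n g W"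
    "L \<in> carrier_mat g g \<Longrightarrow> L' \<in> carrier_mat g g \<Longrightarrow> M \<in> mat_tuples g n \<Longrightarrow> L * L' = 1\<^sub>m g \<Longrightarrow>
     L' * L = 1\<^sub>m g \<Longrightarrow> W (\<lambda>k\<in>{..<n}. L * M k * L') = L * W M * L'"
    "M \<in> mat_tuples g n \<Longrightarrow> W M \<in> carrier_mat g g"
  using assms mat_functions.matrix_functionD(1)[of g n g W M] by (auto simp: equivariant_def)

lemma equivariant_entry:
  assumes "k < n"
  shows "equivariant g n (\<lambda>M. M k)"
  unfolding equivariant_def
proof (intro conjI mat_functions.matrix_functionI)
  show "M k \<in> carrier_mat g g" if "M \<in> mat_tuples g n" for M :: "nat \<Rightarrow> 'a mat"
    using that assms by (auto simp: mat_tuples_def)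
  show "(\<lambda>M. M k $$ (i, j)) \<in> mat_functions g n" if "i < g" "j < g" for i j
    by (rule coordinate_ring_entry) (use assms that in auto)
qed (use assms in auto)

lemma equivariant_scalar: "equivariant g n (\<lambda>_. c \<cdot>\<^sub>m 1\<^sub>m g)"
  unfolding equivariant_def
  by (auto intro!: mat_functions.matrix_function_const simp: mult_smult_distrib[of _ g g _ g] mult_smult_assoc_mat[of _ g g _ g])

lemma equivariant_mult:
  assumes V: "equivariant g n V" and W: "equivariant g n W"
  shows "equivariant g n (\<lambda>M. V M * W M)"
  unfolding equivariant_def
proof (intro conjI ballI impI)
  show "mat_functions.matrix_function g n g (\<lambda>M. V M * W M)"
    by (rule mat_functions.matrix_function_mult[OF equivariantD(1)[OF V] equivariantD(1)[OF W]])
  fix L L' :: "'a mat" and M :: "nat \<Rightarrow> 'a mat"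
  assume L: "L \<in> carrier_mat g g" "L' \<in> carrier_mat g g" and M: "M \<in> mat_tuples g n"
    and inv: "L * L' = 1\<^sub>m g" "L' * L = 1\<^sub>m g"
  note c = equivariantD(3)[OF V M] equivariantD(3)[OF W M]
  have key: "L' * (L * X) = X" if "X \<in> carrier_mat g g" for X
    using that L inv by (simp flip: assoc_mult_mat[of _ g g _ g _ g])
  have "L * V M * L' * (L * W M * L') = L * (V M * W M) * L'"
    using L c by (simp add: assoc_mult_mat[of _ g g _ g _ g] key)
  thus "V (\<lambda>k\<in>{..<n}. L * M k * L') * W (\<lambda>k\<in>{..<n}. L * M k * L') = L * (V M * W M) * L'"
    by (simp only: equivariantD(2)[OF V L M inv] equivariantD(2)[OF W L M inv])
qed

lemma equivariant_diff:
  assumes V: "equivariant g n V" and W: "equivariant g n W"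
  shows "equivariant g n (\<lambda>M. V M - W M)"
  unfolding equivariant_def
proof (intro conjI ballI impI)
  show "mat_functions.matrix_function g n g (\<lambda>M. V M - W M)"
    by (rule mat_functions.matrix_function_diff[OF equivariantD(1)[OF V] equivariantD(1)[OF W]])
  fix L L' :: "'a mat" and M :: "nat \<Rightarrow> 'a mat"
  assume L: "L \<in> carrier_mat g g" "L' \<in> carrier_mat g g" and M: "M \<in> mat_tuples g n"
    and inv: "L * L' = 1\<^sub>m g" "L' * L = 1\<^sub>m g"
  note c = equivariantD(3)[OF V M] equivariantD(3)[OF W M]
  have "L * (V M - W M) * L' = (L * V M - L * W M) * L'"
    by (simp only: mult_minus_distrib_mat[OF L(1) c])
  also have "\<dots> = L * V M * L' - L * W M * L'"
    by (rule minus_mult_distrib_mat[of _ g g _ _ g]) (use L c in simp_all)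
  finally show "V (\<lambda>k\<in>{..<n}. L * M k * L') - W (\<lambda>k\<in>{..<n}. L * M k * L') = L * (V M - W M) * L'"
    by (simp only: equivariantD(2)[OF V L M inv] equivariantD(2)[OF W L M inv])
qed

definition mat_trace :: "nat \<Rightarrow> 'k::field mat \<Rightarrow> 'k" where
  "mat_trace g A = (\<Sum>i<g. A $$ (i, i))"

lemma mat_trace_commute:
  assumes "A \<in> carrier_mat g g" "B \<in> carrier_mat g g"
  shows "mat_trace g (A * B) = mat_trace g (B * A)"
proof -
  have "mat_trace g (A * B) = (\<Sum>i<g. \<Sum>j<g. A $$ (i, j) * B $$ (j, i))"
    using assms by (auto simp: mat_trace_def scalar_prod_def atLeast0LessThan intro!: sum.cong)
  also have "\<dots> = (\<Sum>j<g. \<Sum>i<g. B $$ (j, i) * A $$ (i, j))"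
    by (subst sum.swap) (simp add: mult.commute)
  also have "\<dots> = mat_trace g (B * A)"
    using assms by (auto simp: mat_trace_def scalar_prod_def atLeast0LessThan intro!: sum.cong)
  finally show ?thesis .
qed

lemma invariantI:
  assumes "F \<in> mat_functions g n"
    and "\<And>L L' M. L \<in> carrier_mat g g \<Longrightarrow> L' \<in> carrier_mat g g \<Longrightarrow> M \<in> mat_tuples g n \<Longrightarrow> L * L' = 1\<^sub>m g \<Longrightarrow>
     L' * L = 1\<^sub>m g \<Longrightarrow> F (\<lambda>k\<in>{..<n}. L * M k * L') = F M"
  shows "restrict F (mat_tuples g n) \<in> carrier (mat_invariants g n)"
  unfolding mat_invariants_iff
proof (intro conjI ballI assms(1))
  fix L :: "'a mat" and M :: "nat \<Rightarrow> 'a mat" assume L: "L \<in> SL_mats g" and M: "M \<in> mat_tuples g n"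
  from conj_act_SL[OF L] obtain L' where L': "L' \<in> carrier_mat g g" "L * L' = 1\<^sub>m g" "L' * L = 1\<^sub>m g"
    "conj_act n L M = (\<lambda>k\<in>{..<n}. L * M k * L')" by metis
  show "F (conj_act n L M) = F M"
    unfolding L'(4) using L by (intro assms(2) L' M) (simp add: SL_mats_def)
qed

lemma det_invariant:
  assumes W: "equivariant g n W"
  shows "restrict (\<lambda>M. det (W M)) (mat_tuples g n) \<in> carrier (mat_invariants g n)"
proof (rule invariantI)
  show "(\<lambda>M. det (W M)) \<in> mat_functions g n" by (rule mat_functions.det_closed[OF equivariantD(1)[OF W]])
  fix L L' :: "'a mat" and M :: "nat \<Rightarrow> 'a mat"
  assume L: "L \<in> carrier_mat g g" "L' \<in> carrier_mat g g" and M: "M \<in> mat_tuples g n"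
    and inv: "L * L' = 1\<^sub>m g" "L' * L = 1\<^sub>m g"
  have "det L * det L' = 1" using arg_cong[OF inv(1), of det] det_mult[OF L] by simp
  moreover have "det (L * W M * L') = det L * det (W M) * det L'"
    using L equivariantD(3)[OF W M] by (simp add: det_mult[of _ g] del: assoc_mult_mat)
  ultimately show "det (W (\<lambda>k\<in>{..<n}. L * M k * L')) = det (W M)"
    by (simp add: equivariantD(2)[OF W L M inv] mult.assoc mult.left_commute[of _ "det (W M)"])
qed

lemma trace_invariant:
  assumes W: "equivariant g n W"
  shows "restrict (\<lambda>M. mat_trace g (W M)) (mat_tuples g n) \<in> carrier (mat_invariants g n)"
proof (rule invariantI)
  show "(\<lambda>M. mat_trace g (W M)) \<in> mat_functions g n"
    unfolding mat_trace_def by (rule mat_functions.trace_closed[OF equivariantD(1)[OF W]])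
  fix L L' :: "'a mat" and M :: "nat \<Rightarrow> 'a mat"
  assume L: "L \<in> carrier_mat g g" "L' \<in> carrier_mat g g" and M: "M \<in> mat_tuples g n"
    and inv: "L * L' = 1\<^sub>m g" "L' * L = 1\<^sub>m g"
  note c = equivariantD(3)[OF W M]
  have "mat_trace g (L * W M * L') = mat_trace g (L' * (L * W M))"
    using L c by (intro mat_trace_commute) auto
  also have "L' * (L * W M) = W M"
    using L c inv by (simp flip: assoc_mult_mat[of _ g g _ g _ g])
  finally show "mat_trace g (W (\<lambda>k\<in>{..<n}. L * M k * L')) = mat_trace g (W M)"
    by (simp only: equivariantD(2)[OF W L M inv])
qed

section \<open>Values of invariants on the slice\<close>

text \<open>The product of the last \<open>m\<close> components. Components count from 0, so the
  product \<open>N\<close> belonging to \<open>Q_k\<close> is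
  \<open>tail_product g n (n - k)\<close>. The base is written as a scalar matrix to fit
  \<open>equivariant_scalar\<close>.\<close>

primrec tail_product :: "nat \<Rightarrow> nat \<Rightarrow> nat \<Rightarrow> (nat \<Rightarrow> 'k::field mat) \<Rightarrow> 'k mat" where
  "tail_product g n 0 M = 1 \<cdot>\<^sub>m 1\<^sub>m g"
| "tail_product g n (Suc m) M = M (n - Suc m) * tail_product g n m M"

lemma tail_product_equivariant:
  "m \<le> n \<Longrightarrow> equivariant g n (tail_product g n m :: (nat \<Rightarrow> 'k::field mat) \<Rightarrow> 'k mat)"
proof (induction m)
  case 0
  show ?case using equivariant_scalar[of g n 1] by (simp add: tail_product.simps(1)[abs_def])
next
  case (Suc m)
  have "equivariant g n (\<lambda>M :: nat \<Rightarrow> 'k mat. M (n - Suc m) * tail_product g n m M)"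
    using Suc by (intro equivariant_mult equivariant_entry) auto
  moreover have "tail_product g n (Suc m) = (\<lambda>M. M (n - Suc m) * tail_product g n m M)" by auto
  ultimately show ?case by simp
qed

text \<open>The product telescopes: each inner \<open>adj_mat (Q k) * Q k\<close> collapses to the
  scalar \<open>det (Q k)\<close>, starting from the identity at the end.\<close>

lemma tail_product_pi_map:
  fixes Q :: "nat \<Rightarrow> 'k::field mat"
  assumes Q: "Q \<in> sym_tuples g n" and Qn: "Q n = 1\<^sub>m g"
  shows "m \<le> n \<Longrightarrow> tail_product g n m (pi_map n Q) = (\<Prod>j<m. det (Q (n - j))) \<cdot>\<^sub>m Q (n - m)"
proof (induction m)
  case 0
  show ?case by (simp add: Qn)
next
  case (Suc m)
  have Qc: "Q k \<in> carrier_mat g g" if "k \<le> n" for k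
    using Q that by (auto simp: sym_tuples_def sym_mats_def PiE_iff)
  let ?A = "Q (n - Suc m)" and ?B = "Q (n - m)" and ?c = "\<Prod>j<m. det (Q (n - j))"
  have A: "?A \<in> carrier_mat g g" and B: "?B \<in> carrier_mat g g" using Suc.prems by (auto intro: Qc)
  have "Suc (n - Suc m) = n - m" using Suc.prems by simp
  hence "pi_map n Q (n - Suc m) = ?A * adj_mat ?B" using Suc.prems by (simp add: pi_map_def)
  hence "tail_product g n (Suc m) (pi_map n Q) = ?A * adj_mat ?B * (?c \<cdot>\<^sub>m ?B)" using Suc by simp
  also have "\<dots> = ?c \<cdot>\<^sub>m (?A * (adj_mat ?B * ?B))"
    using A B adj_mat(1)[OF B]
    by (simp add: mult_smult_distrib[of _ g g _ g] assoc_mult_mat[of _ g g _ g _ g])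
  also have "?A * (adj_mat ?B * ?B) = det ?B \<cdot>\<^sub>m ?A"
    unfolding adj_mat(3)[OF B] using A by (simp add: mult_smult_distrib[of _ g g _ g])
  also have "?c \<cdot>\<^sub>m (det ?B \<cdot>\<^sub>m ?A) = (\<Prod>j<Suc m. det (Q (n - j))) \<cdot>\<^sub>m ?A" by (auto intro!: eq_matI)
  finally show ?case .
qed

text \<open>If \<open>bs\<close> lists all eigenvalues of \<open>M (n - 1)\<close> but one, and they
  are distinct, this is an unnormalised Lagrange projector onto the remaining eigenspace.\<close>

primrec spectral_product :: "nat \<Rightarrow> nat \<Rightarrow> 'k list \<Rightarrow> (nat \<Rightarrow> 'k::field mat) \<Rightarrow> 'k mat" where
  "spectral_product g n [] M = 1 \<cdot>\<^sub>m 1\<^sub>m g"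
| "spectral_product g n (b # bs) M = (M (n - 1) - b \<cdot>\<^sub>m 1\<^sub>m g) * spectral_product g n bs M"

lemma spectral_product_equivariant: "n \<ge> 1 \<Longrightarrow> equivariant g n (spectral_product g n bs)"
proof (induction bs)
  case Nil
  show ?case using equivariant_scalar[of g n 1] by (simp add: spectral_product.simps(1)[abs_def])
next
  case (Cons b bs)
  have "equivariant g n (\<lambda>M. (M (n - 1) - b \<cdot>\<^sub>m 1\<^sub>m g) * spectral_product g n bs M)"
    using Cons by (intro equivariant_mult equivariant_diff equivariant_scalar equivariant_entry) auto
  moreover have "spectral_product g n (b # bs) =
      (\<lambda>M. (M (n - 1) - b \<cdot>\<^sub>m 1\<^sub>m g) * spectral_product g n bs M)" by auto
  ultimately show ?case by simp
qed

lemma mat_diag_minus_scalar: "mat_diag g a - b \<cdot>\<^sub>m 1\<^sub>m g = mat_diag g (\<lambda>r. a r - b :: 'k::field)"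
  by (rule eq_matI) (auto simp: mat_diag_def)

lemma spectral_product_diag:
  assumes "M (n - 1) = mat_diag g a"
  shows "spectral_product g n bs M = mat_diag g (\<lambda>r. \<Prod>b\<leftarrow>bs. a r - b)"
proof (induction bs)
  case Nil
  show ?case by (auto simp: mat_diag_def intro!: eq_matI)
next
  case (Cons b bs)
  show ?case by (simp add: Cons.IH assms mat_diag_minus_scalar del: One_nat_def)
qed

text \<open>The trace is the double sum of \<open>d r * N $$ (r, s) * e s * N $$ (s, r)\<close>, and
  only \<open>r = i\<close>, \<open>s = j\<close> survives.\<close>

lemma mat_trace_diag_units:
  fixes N :: "'k::field mat"
  assumes N: "N \<in> carrier_mat g g" and ij: "i < g" "j < g"
    and d: "\<And>r. r < g \<Longrightarrow> r \<noteq> i \<Longrightarrow> d r = 0" and e: "\<And>r. r < g \<Longrightarrow> r \<noteq> j \<Longrightarrow> e r = 0"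
  shows "mat_trace g ((mat_diag g d * N) * (mat_diag g e * N)) = d i * e j * N $$ (i, j) * N $$ (j, i)"
proof -
  have "mat_trace g ((mat_diag g d * N) * (mat_diag g e * N)) =
      (\<Sum>r<g. \<Sum>s<g. (d r * N $$ (r, s)) * (e s * N $$ (s, r)))"
    unfolding mat_diag_mult_left[OF N]
    by (auto simp: mat_trace_def scalar_prod_def atLeast0LessThan intro!: sum.cong)
  also have "\<dots> = (\<Sum>r<g. if r = i then \<Sum>s<g. if s = j then d i * N $$ (i, j) * (e j * N $$ (j, i)) else 0 else 0)"
  proof (intro sum.cong refl)
    fix r assume "r \<in> {..<g}"
    hence r: "d r = 0 \<or> r = i" using d by auto
    have "(\<Sum>s<g. d i * N $$ (i, s) * (e s * N $$ (s, i))) =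
        (\<Sum>s<g. if s = j then d i * N $$ (i, j) * (e j * N $$ (j, i)) else 0)"
      by (intro sum.cong refl) (auto simp: e)
    thus "(\<Sum>s<g. d r * N $$ (r, s) * (e s * N $$ (s, r))) =
        (if r = i then \<Sum>s<g. if s = j then d i * N $$ (i, j) * (e j * N $$ (j, i)) else 0 else 0)"
      using r by auto
  qed
  also have "\<dots> = d i * e j * N $$ (i, j) * N $$ (j, i)" using ij by (simp add: mult_ac)
  finally show ?thesis .
qed

lemma pi_map_slice_last:
  "n \<ge> 1 \<Longrightarrow> pi_map n (slice g n \<tau>) (n - 1) = mat_diag g (\<lambda>i. \<tau> (0, i, i))"
  by (cases n) (simp_all add: pi_map_def slice_def adj_mat_one right_mult_one_mat[of _ g g])

lemma det_invariant_slice: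
  assumes "n \<ge> 1"
  shows "det (pi_map n (slice g n \<tau>) (n - 1) - b \<cdot>\<^sub>m 1\<^sub>m g) = (\<Prod>r<g. \<tau> (0, r, r) - b)"
  unfolding pi_map_slice_last[OF assms] mat_diag_minus_scalar det_mat_diag ..

text \<open>Two copies of the tail are needed to reach off-diagonal entries. Diagonal sign matrices
  act on the slice and change the sign of such an entry, so it is not invariant by itself, but its
  product with the transposed entry is.\<close>

definition separating_word :: "nat \<Rightarrow> nat \<Rightarrow> (nat \<Rightarrow> 'k) \<Rightarrow> nat \<Rightarrow> nat \<Rightarrow> nat \<Rightarrow> (nat \<Rightarrow> 'k::field mat) \<Rightarrow> 'k mat" where
  "separating_word g n \<alpha> l i j M =
     (spectral_product g n (map \<alpha> (filter (\<lambda>r. r \<noteq> i) [0..<g])) M * tail_product g n (n - l) M) *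
     (spectral_product g n (map \<alpha> (filter (\<lambda>r. r \<noteq> j) [0..<g])) M * tail_product g n (n - l) M)"

lemma separating_word_equivariant: "n \<ge> 1 \<Longrightarrow> equivariant g n (separating_word g n \<alpha> l i j)"
  unfolding separating_word_def[abs_def]
  by (intro equivariant_mult spectral_product_equivariant tail_product_equivariant) auto

lemma separating_word_slice:
  fixes \<tau> :: "nat \<times> nat \<times> nat \<Rightarrow> 'k::field"
  assumes n: "n \<ge> 1" and l: "l \<le> n" and ij: "i < g" "j < g" and \<alpha>: "inj \<alpha>"
    and \<tau>: "\<And>r. r < g \<Longrightarrow> \<tau> (0, r, r) = \<alpha> r"
  obtains u where "u \<noteq> 0" "mat_trace g (separating_word g n \<alpha> l i j (pi_map n (slice g n \<tau>))) =
    u * (\<Prod>j<n - l. det (slice g n \<tau> (n - j)))\<^sup>2 * slice g n \<tau> l $$ (i, j) * slice g n \<tau> l $$ (j, i)"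
proof -
  let ?Q = "slice g n \<tau>"
  let ?c = "\<Prod>j<n - l. det (?Q (n - j))"
  let ?d = "\<lambda>i r. \<Prod>b\<leftarrow>map \<alpha> (filter (\<lambda>r. r \<noteq> i) [0..<g]). \<alpha> r - b"
  have Q: "?Q \<in> sym_tuples g n" by (rule slice_in_sym_tuples)
  have Ql: "?Q l \<in> carrier_mat g g" using Q l by (auto simp: sym_tuples_def sym_mats_def PiE_iff)
  have diag: "pi_map n ?Q (n - 1) = mat_diag g \<alpha>"
    unfolding pi_map_slice_last[OF n] using \<tau> by (auto simp: mat_diag_def intro!: eq_matI)
  have tail: "tail_product g n (n - l) (pi_map n ?Q) = ?c \<cdot>\<^sub>m ?Q l"
    using tail_product_pi_map[OF Q, of "n - l"] l by (simp add: slice_def)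
  have d0: "?d i r = 0" if "r < g" "r \<noteq> i" for i r using that by (auto simp: prod_list_zero_iff)
  have "mat_trace g (separating_word g n \<alpha> l i j (pi_map n ?Q)) =
      ?d i i * ?d j j * (?c \<cdot>\<^sub>m ?Q l) $$ (i, j) * (?c \<cdot>\<^sub>m ?Q l) $$ (j, i)"
    unfolding separating_word_def tail spectral_product_diag[where M = "pi_map n ?Q" and a = \<alpha>, OF diag]
    using Ql d0 by (intro mat_trace_diag_units ij) auto
  also have "\<dots> = ?d i i * ?d j j * ?c\<^sup>2 * ?Q l $$ (i, j) * ?Q l $$ (j, i)"
    using Ql ij by (simp add: power2_eq_square mult_ac)
  finally have "mat_trace g (separating_word g n \<alpha> l i j (pi_map n ?Q)) =
      ?d i i * ?d j j * ?c\<^sup>2 * ?Q l $$ (i, j) * ?Q l $$ (j, i)" .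
  moreover have "?d i i \<noteq> 0" for i using \<alpha> by (auto simp: prod_list_zero_iff inj_eq)
  ultimately show ?thesis using that[of "?d i i * ?d j j"] by simp
qed

text \<open>The pairs \<open>i \<le> j\<close> are fibred over the larger index, which makes their
  number the sum of the \<open>Suc j\<close>.\<close>

definition slice_index :: "nat \<Rightarrow> nat \<Rightarrow> (nat \<times> nat \<times> nat) set" where
  "slice_index g n = (\<lambda>i. (0, i, i)) ` {..<g} \<union>
     (\<lambda>(k, j, i). (Suc k, i, j)) ` ({..<n - 1} \<times> (SIGMA j:{..<g}. {..j}))"

lemma finite_slice_index: "finite (slice_index g n)"
  by (simp add: slice_index_def)

lemma card_slice_index: "card (slice_index g n) = (n - 1) * (g * (g + 1) div 2) + g"
proof -
  have "card (SIGMA j:{..<g}. {..j}) = (\<Sum>j<g. Suc j)" by simp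
  also have "\<dots> = g * (g + 1) div 2" by (induction g) auto
  finally have "card ((\<lambda>(k, j, i). (Suc k, i, j)) ` ({..<n - 1} \<times> (SIGMA j:{..<g}. {..j}))) =
      (n - 1) * (g * (g + 1) div 2)"
    by (subst card_image) (auto simp: inj_on_def card_cartesian_product)
  moreover have "card ((\<lambda>i. (0 :: nat, i, i)) ` {..<g}) = g" by (subst card_image) (auto simp: inj_on_def)
  ultimately show ?thesis
    unfolding slice_index_def by (subst card_Un_disjoint) auto
qed

text \<open>Applied to the coordinate functions themselves in the upper bound and to lines of
  parameters in the lower bound.\<close>

lemma slice_matrix_function:
  assumes "function_algebra T R" and \<tau>: "\<And>z. z \<in> slice_index g n \<Longrightarrow> (\<lambda>s. \<tau> s z) \<in> R" and k: "k \<le> n"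
  shows "function_algebra.matrix_function T R g (\<lambda>s. slice g n (\<tau> s) k)"
proof -
  interpret function_algebra T R by fact
  consider "k = n" | "Suc k = n" | "Suc k < n" using k by linarith
  thus ?thesis
  proof cases
    case 1
    thus ?thesis by (simp add: slice_def matrix_function_const)
  next
    case 2
    show ?thesis
    proof (rule matrix_functionI)
      fix i j assume ij: "i < g" "j < g"
      show "(\<lambda>s. slice g n (\<tau> s) k $$ (i, j)) \<in> R"
      proof (cases "i = j")
        case True
        have "(\<lambda>s. \<tau> s (0, j, j)) \<in> R" using ij by (intro \<tau>) (auto simp: slice_index_def)
        thus ?thesis using 2 ij True by (auto simp: slice_def mat_diag_index)
      next
        case False
        thus ?thesis using 2 ij const_closed[of 0] by (auto simp: slice_def mat_diag_index)
      qed
    qed (use 2 in \<open>auto simp: slice_def\<close>)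
  next
    case 3
    show ?thesis
    proof (rule matrix_functionI)
      fix i j assume ij: "i < g" "j < g"
      have "(Suc k, min i j, max i j) \<in> slice_index g n"
        using 3 ij by (auto simp: slice_index_def image_iff intro!: bexI[of _ "(k, max i j, min i j)"])
      from \<tau>[OF this] show "(\<lambda>s. slice g n (\<tau> s) k $$ (i, j)) \<in> R"
        using 3 ij by (simp add: slice_def)
    qed (use 3 in \<open>auto simp: slice_def\<close>)
  qed
qed

section \<open>The dimension of the image\<close>

definition image_functions :: "nat \<Rightarrow> nat \<Rightarrow> ((nat \<Rightarrow> 'k::field mat) \<Rightarrow> 'k) set" where
  "image_functions g n = {F. \<exists>f\<in>{f. restrict f (mat_tuples g n) \<in> carrier (mat_invariants g n)}.
     \<forall>Q\<in>sym_tuples g n. F Q = f (pi_map n Q)}"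

interpretation image_functions: function_algebra "sym_tuples g n" "image_functions g n" for g n
  unfolding image_functions_def
  by (rule function_algebra_pullback[OF mat_invariants_function_algebra]) (rule pi_map_in_mat_tuples)

lemma image_functionsD:
  assumes "F \<in> image_functions g n"
  obtains f where "f \<in> carrier (mat_invariants g n)" "\<And>Q. Q \<in> sym_tuples g n \<Longrightarrow> F Q = f (pi_map n Q)"
proof -
  from assms obtain f where f: "restrict f (mat_tuples g n) \<in> carrier (mat_invariants g n)"
    "\<forall>Q\<in>sym_tuples g n. F Q = f (pi_map n Q)" by (auto simp: image_functions_def)
  show ?thesis
    by (rule that[OF f(1)]) (use f(2) pi_map_in_mat_tuples in auto)
qed

lemma image_functionsI:
  assumes "restrict f (mat_tuples g n) \<in> carrier (mat_invariants g n)"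
  shows "(\<lambda>Q. f (pi_map n Q)) \<in> image_functions g n"
  using assms by (auto simp: image_functions_def)

text \<open>Both rings carry the pointwise operations of \<open>fun_ring\<close> on symmetric
  tuples, so only the carriers have to be compared.\<close>

lemma image_ring_eq:
  "(sym_invariants g n)\<lparr>carrier := pi_star g n `
     carrier (mat_invariants g n :: ((nat \<Rightarrow> 'k::field mat) \<Rightarrow> 'k) ring)\<rparr> =
   image_functions.function_ring g n"
proof -
  have "pi_star g n ` carrier (mat_invariants g n :: ((nat \<Rightarrow> 'k mat) \<Rightarrow> 'k) ring) =
      (\<lambda>F. restrict F (sym_tuples g n)) ` image_functions g n"
  proof (intro equalityI subsetI)
    fix F assume "F \<in> pi_star g n ` carrier (mat_invariants g n)"
    then obtain f where f: "f \<in> carrier (mat_invariants g n)" "F = pi_star g n f" by blast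
    have "f \<in> mat_tuples g n \<rightarrow>\<^sub>E UNIV"
      using f(1) mat_invariants_subset by (intro coordinate_ring_extensional) blast
    hence "restrict f (mat_tuples g n) = f" by (auto simp: PiE_def extensional_restrict)
    hence "(\<lambda>Q. f (pi_map n Q)) \<in> image_functions g n" using f(1) by (intro image_functionsI) simp
    moreover have "F = restrict (\<lambda>Q. f (pi_map n Q)) (sym_tuples g n)" by (simp add: f(2) pi_star_def)
    ultimately show "F \<in> (\<lambda>F. restrict F (sym_tuples g n)) ` image_functions g n" by blast
  next
    fix H assume "H \<in> (\<lambda>F. restrict F (sym_tuples g n)) ` image_functions g n"
    then obtain F where F: "F \<in> image_functions g n" "H = restrict F (sym_tuples g n)" by blast
    from image_functionsD[OF F(1)] obtain f where f: "f \<in> carrier (mat_invariants g n)"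
      "\<And>Q. Q \<in> sym_tuples g n \<Longrightarrow> F Q = f (pi_map n Q)" by blast
    have "H = pi_star g n f" using f(2) by (auto simp: F(2) pi_star_def)
    thus "H \<in> pi_star g n ` carrier (mat_invariants g n)" using f(1) by blast
  qed
  thus ?thesis by (simp add: sym_invariants_def coordinate_ring_def)
qed

lemma image_functions_subst:
  assumes F: "F \<in> image_functions g n" and R: "function_algebra T R"
    and Q: "\<And>s. s \<in> T \<Longrightarrow> Q s \<in> sym_tuples g n"
    and entries: "\<And>k. k \<le> n \<Longrightarrow> function_algebra.matrix_function T R g (\<lambda>s. Q s k)"
  shows "(\<lambda>s. F (Q s)) \<in> R"
proof -
  from image_functionsD[OF F] obtain f where f: "f \<in> carrier (mat_invariants g n)"
    "\<And>Q. Q \<in> sym_tuples g n \<Longrightarrow> F Q = f (pi_map n Q)" by blast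
  have "(\<lambda>s. f (pi_map n (Q s))) \<in> R"
    using f(1) mat_invariants_subset by (intro coordinate_ring_pi_map[OF _ R Q entries]) blast+
  thus ?thesis by (rule function_algebra.cong_closed[OF R]) (simp add: f(2) Q)
qed

lemma monomial_comp: "monomial x es (h s) = monomial (\<lambda>i s. x i (h s)) es s"
  by (induction es arbitrary: x) auto

lemma krull_dim_image_le:
  assumes g: "g \<ge> 1" and n: "n \<ge> 1"
  shows "krull_dim (image_functions.function_ring g n :: ((nat \<Rightarrow> 'k::alg_closed_field mat) \<Rightarrow> 'k) ring)
    \<le> enat (card (slice_index g n))"
proof (rule image_functions.krull_dim_le)
  fix k and x :: "nat \<Rightarrow> (nat \<Rightarrow> 'k mat) \<Rightarrow> 'k"
  assume k: "k > card (slice_index g n)" and x: "\<And>i. i < k \<Longrightarrow> x i \<in> image_functions g n"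
  let ?R = "\<Union>D. box_polys (slice_index g n) D :: ((nat \<times> nat \<times> nat \<Rightarrow> 'k) \<Rightarrow> 'k) set"
  have poly: "(\<lambda>\<tau>. x i (slice g n \<tau>)) \<in> ?R" if i: "i < k" for i
  proof (rule image_functions_subst[OF x[OF i] box_polys_function_algebra slice_in_sym_tuples])
    fix l assume "l \<le> n"
    thus "function_algebra.matrix_function UNIV ?R g (\<lambda>\<tau>. slice g n \<tau> l)"
      using box_polys_coordinate[OF finite_slice_index]
      by (intro slice_matrix_function[OF box_polys_function_algebra]) blast+
  qed
  show "\<exists>E c e. finite E \<and> (\<forall>e\<in>E. length e = k) \<and> e \<in> E \<and> c e \<noteq> 0 \<and>
      (\<forall>s\<in>sym_tuples g n. (\<Sum>e\<in>E. c e * monomial x e s) = 0)"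
  proof (rule polynomials_dependent[OF finite_slice_index k poly])
    fix E e and c :: "nat list \<Rightarrow> 'k"
    assume E: "finite E" "\<And>e. e \<in> E \<Longrightarrow> length e = k" "e \<in> E" "c e \<noteq> 0"
      "\<And>\<tau>. (\<Sum>e\<in>E. c e * monomial (\<lambda>i \<tau>. x i (slice g n \<tau>)) e \<tau>) = 0"
    \<comment> \<open>The relation found on the slice is itself an element of the image, because the
      image is an algebra. It therefore extends from the slice to all symmetric tuples.\<close>
    define \<Phi> where "\<Phi> Q = (\<Sum>e\<in>E. c e * monomial x e Q)" for Q
    have \<Phi>: "\<Phi> \<in> image_functions g n"
      unfolding \<Phi>_def[abs_def] using x E(2)
      by (intro image_functions.sum_closed image_functions.cmult_closed image_functions.monomial_closed) auto
    have "\<Phi> Q = 0" if "Q \<in> sym_tuples g n" for Q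
    proof (rule vanishing_on_slice[OF g n _ _ _ that])
      fix Q Q' :: "nat \<Rightarrow> 'k mat" assume Q: "Q \<in> sym_tuples g n" "Q' \<in> sym_tuples g n"
      show "(\<lambda>t. \<Phi> (tuple_line n Q Q' t)) \<in> range poly"
        by (rule image_functions_subst[OF \<Phi> univariate.function_algebra_axioms tuple_line_in_sym_tuples[OF Q]
            tuple_line_matrix_function[OF Q]])
      from image_functionsD[OF \<Phi>] obtain f where "f \<in> carrier (mat_invariants g n)"
        "\<And>Q. Q \<in> sym_tuples g n \<Longrightarrow> \<Phi> Q = f (pi_map n Q)" by blast
      thus "\<Phi> Q = \<Phi> Q'"
        if "\<And>f. f \<in> carrier (mat_invariants g n) \<Longrightarrow> f (pi_map n Q) = f (pi_map n Q')" using that Q by simp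
    next
      fix \<tau>
      show "\<Phi> (slice g n \<tau>) = 0" using E(5)[of \<tau>] by (simp add: \<Phi>_def monomial_comp)
    qed
    thus "\<exists>E c e. finite E \<and> (\<forall>e\<in>E. length e = k) \<and> e \<in> E \<and> c e \<noteq> 0 \<and>
        (\<forall>s\<in>sym_tuples g n. (\<Sum>e\<in>E. c e * monomial x e s) = 0)"
      using E(1-4) by (intro exI[of _ E] exI[of _ c] exI[of _ e]) (auto simp: \<Phi>_def)
  qed
qed

definition base_point :: "(nat \<Rightarrow> 'k) \<Rightarrow> nat \<times> nat \<times> nat \<Rightarrow> 'k::field" where
  "base_point \<alpha> = (\<lambda>(k, i, j). if k = 0 then \<alpha> i else 0)"

text \<open>One step of the chain, with \<open>z\<close> the coordinate being fixed. Coordinates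
  after \<open>z\<close> are unconstrained, so the witness may choose them to keep the determinants
  in the separating trace nonzero.\<close>

lemma slice_separation:
  fixes \<alpha> :: "nat \<Rightarrow> 'k::field"
  assumes n: "n \<ge> 1" and \<alpha>: "inj \<alpha>" "\<And>i. \<alpha> i \<noteq> 0" and z: "z \<in> slice_index g n"
  obtains F \<tau>\<^sub>0 where "F \<in> image_functions g n"
    "\<And>\<tau>. (\<And>y. y \<in> slice_index g n \<Longrightarrow> y \<le> z \<Longrightarrow> \<tau> y = base_point \<alpha> y) \<Longrightarrow> F (slice g n \<tau>) = 0"
    "\<And>y. y < z \<Longrightarrow> \<tau>\<^sub>0 y = base_point \<alpha> y" "F (slice g n \<tau>\<^sub>0) \<noteq> 0"
proof -
  consider i where "z = (0, i, i)" "i < g"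
    | l i j where "z = (Suc l, i, j)" "Suc l < n" "i \<le> j" "j < g"
    using z by (auto simp: slice_index_def)
  thus ?thesis
  proof cases
    case (1 i)
    let ?f = "\<lambda>M. det (M (n - 1) - \<alpha> i \<cdot>\<^sub>m 1\<^sub>m g)"
    have "equivariant g n (\<lambda>M. M (n - 1) - \<alpha> i \<cdot>\<^sub>m 1\<^sub>m g)"
      using n by (intro equivariant_diff equivariant_entry equivariant_scalar) auto
    hence f: "restrict ?f (mat_tuples g n) \<in> carrier (mat_invariants g n)" by (rule det_invariant)
    show ?thesis
    \<comment> \<open>The value \<open>\<alpha> g\<close> is spare: it differs from
      \<open>\<alpha> i\<close>, and so do the earlier \<open>\<alpha> r\<close>, so no factor of
      the determinant vanishes.\<close>
    proof (rule that[OF image_functionsI[OF f], of "\<lambda>y. if y < z then base_point \<alpha> y else \<alpha> g"])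
      fix \<tau> assume \<tau>: "\<And>y. y \<in> slice_index g n \<Longrightarrow> y \<le> z \<Longrightarrow> \<tau> y = base_point \<alpha> y"
      have "\<tau> (0, i, i) = \<alpha> i" using \<tau>[OF z order_refl] by (simp add: 1 base_point_def)
      thus "det (pi_map n (slice g n \<tau>) (n - 1) - \<alpha> i \<cdot>\<^sub>m 1\<^sub>m g) = 0"
        unfolding det_invariant_slice[OF n] using 1(2) by (intro prod_zero) auto
    next
      show "det (pi_map n (slice g n (\<lambda>y. if y < z then base_point \<alpha> y else \<alpha> g)) (n - 1) - \<alpha> i \<cdot>\<^sub>m 1\<^sub>m g) \<noteq> 0"
        unfolding det_invariant_slice[OF n] using 1 \<alpha>(1)
        by (auto simp: prod_zero_iff base_point_def inj_eq)
    qed auto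
  next
    case (2 l i j)
    let ?f = "\<lambda>M. mat_trace g (separating_word g n \<alpha> l i j M)"
    have f: "restrict ?f (mat_tuples g n) \<in> carrier (mat_invariants g n)"
      by (rule trace_invariant[OF separating_word_equivariant[OF n]])
    have l: "l \<le> n" and ij: "i < g" "j < g" using 2 by auto
    \<comment> \<open>The entry at \<open>z\<close> is 1, and the coordinates after \<open>z\<close>
      describe identity matrices. All components strictly between \<open>l\<close> and
      \<open>n - 1\<close> thus become the identity.\<close>
    define \<tau>\<^sub>0 where "\<tau>\<^sub>0 y = (if y < z then base_point \<alpha> y else if y = z \<or> fst (snd y) = snd (snd y) then 1 else 0)" for y
    show ?thesis
    proof (rule that[OF image_functionsI[OF f], of \<tau>\<^sub>0])
      fix \<tau> assume \<tau>: "\<And>y. y \<in> slice_index g n \<Longrightarrow> y \<le> z \<Longrightarrow> \<tau> y = base_point \<alpha> y"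
      have "\<tau> (0, r, r) = \<alpha> r" if "r < g" for r
        using that by (subst \<tau>) (auto simp: 2 slice_index_def base_point_def)
      from separating_word_slice[where \<tau> = \<tau>, OF n l ij \<alpha>(1) this] obtain u where
        "?f (pi_map n (slice g n \<tau>)) = u * (\<Prod>j<n - l. det (slice g n \<tau> (n - j)))\<^sup>2 *
          slice g n \<tau> l $$ (i, j) * slice g n \<tau> l $$ (j, i)" by metis
      moreover have "slice g n \<tau> l $$ (i, j) = 0"
        using \<tau>[OF z order_refl] 2 by (simp add: slice_def base_point_def min_def max_def)
      ultimately show "?f (pi_map n (slice g n \<tau>)) = 0" by simp
    next
      show "\<tau>\<^sub>0 y = base_point \<alpha> y" if "y < z" for y using that by (simp add: \<tau>\<^sub>0_def)
      have diag: "\<tau>\<^sub>0 (0, r, r) = \<alpha> r" if "r < g" for r by (simp add: \<tau>\<^sub>0_def 2 base_point_def)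
      from separating_word_slice[where \<tau> = \<tau>\<^sub>0, OF n l ij \<alpha>(1) diag] obtain u where u: "u \<noteq> 0"
        "?f (pi_map n (slice g n \<tau>\<^sub>0)) = u * (\<Prod>j<n - l. det (slice g n \<tau>\<^sub>0 (n - j)))\<^sup>2 *
          slice g n \<tau>\<^sub>0 l $$ (i, j) * slice g n \<tau>\<^sub>0 l $$ (j, i)" by metis
      have "det (slice g n \<tau>\<^sub>0 (n - m)) \<noteq> 0" if m: "m < n - l" for m
      proof -
        \<comment> \<open>The components after \<open>l\<close>: the identity at the end, then the
          diagonal matrix of the \<open>\<alpha> i\<close>, then components whose coordinates all
          come after \<open>z\<close>.\<close>
        consider "m = 0" | "m = 1" | "Suc (n - m) < n" using m by linarith
        thus ?thesis
        proof cases
          case 1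
          thus ?thesis by (simp add: slice_def)
        next
          case 2
          hence "slice g n \<tau>\<^sub>0 (n - m) = mat_diag g (\<lambda>i. \<tau>\<^sub>0 (0, i, i))"
            using n by (auto simp: slice_def)
          thus ?thesis using \<alpha>(2) by (simp add: det_mat_diag prod_zero_iff diag)
        next
          case 3
          have "\<tau>\<^sub>0 (Suc (n - m), min i j, max i j) = (if i = j then 1 else 0)" for i j
            using m 2 by (auto simp: \<tau>\<^sub>0_def min_def max_def)
          hence "slice g n \<tau>\<^sub>0 (n - m) = 1\<^sub>m g"
            using 3 by (auto simp: slice_def intro!: eq_matI)
          thus ?thesis by simp
        qed
      qed
      hence "(\<Prod>j<n - l. det (slice g n \<tau>\<^sub>0 (n - j))) \<noteq> 0" by (auto simp: prod_zero_iff)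
      moreover have "slice g n \<tau>\<^sub>0 l $$ (i, j) = 1" "slice g n \<tau>\<^sub>0 l $$ (j, i) = 1"
        using 2 by (auto simp: slice_def \<tau>\<^sub>0_def min_def max_def)
      ultimately show "?f (pi_map n (slice g n \<tau>\<^sub>0)) \<noteq> 0" using u by simp
    qed
  qed
qed

lemma krull_dim_image_ge:
  assumes n: "n \<ge> 1"
  shows "enat (card (slice_index g n)) \<le>
    krull_dim (image_functions.function_ring g n :: ((nat \<Rightarrow> 'k::alg_closed_field mat) \<Rightarrow> 'k) ring)"
proof -
  obtain \<alpha> :: "nat \<Rightarrow> 'k" where \<alpha>: "inj \<alpha>" "range \<alpha> \<subseteq> UNIV - {0}"
    using infinite_countable_subset[of "UNIV - {0 :: 'k}"] infinite_alg_closed_field by auto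
  hence \<alpha>0: "\<alpha> i \<noteq> 0" for i by auto
  \<comment> \<open>Triples are compared lexicographically, so \<open>take i zs\<close> consists of
    the coordinates strictly below \<open>zs ! i\<close>.\<close>
  define zs where "zs = sorted_list_of_set (slice_index g n)"
  have zs: "set zs = slice_index g n" "length zs = card (slice_index g n)" "sorted_wrt (<) zs"
    using finite_slice_index by (simp_all add: zs_def)
  define C where "C i = {\<tau> :: nat \<times> nat \<times> nat \<Rightarrow> 'k. \<forall>y\<in>set (take i zs). \<tau> y = base_point \<alpha> y}" for i
  show ?thesis
  proof (rule image_functions.krull_dim_ge[where Z = "\<lambda>i. slice g n ` C i"])
    show "slice g n ` C (Suc i) \<subseteq> slice g n ` C i" for i
      using set_take_subset_set_take[of i "Suc i" zs] by (intro image_mono) (auto simp: C_def)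
    show "slice g n ` C (card (slice_index g n)) \<noteq> {}" by (auto simp: C_def)
    show "slice g n ` C 0 \<subseteq> sym_tuples g n" using slice_in_sym_tuples by blast
  next
    fix i and F G :: "(nat \<Rightarrow> 'k mat) \<Rightarrow> 'k"
    assume F: "F \<in> image_functions g n" and G: "G \<in> image_functions g n"
      and FG: "\<forall>s\<in>slice g n ` C i. F s * G s = 0"
    show "(\<forall>s\<in>slice g n ` C i. F s = 0) \<or> (\<forall>s\<in>slice g n ` C i. G s = 0)"
    proof (rule ccontr)
      assume "\<not> ?thesis"
      then obtain \<tau> \<tau>' where \<tau>: "\<tau> \<in> C i" "F (slice g n \<tau>) \<noteq> 0" and \<tau>': "\<tau>' \<in> C i" "G (slice g n \<tau>') \<noteq> 0"
        by blast
      \<comment> \<open>The set \<open>C i\<close> is affine, so the line through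
        \<open>\<tau>\<close> and \<open>\<tau>'\<close> stays inside it. Along it \<open>F\<close>
        and \<open>G\<close> are polynomials, nonzero at parameters 0 and 1 respectively, and their
        product cannot vanish everywhere.\<close>
      define \<sigma> where "\<sigma> t z = (1 - t) * \<tau> z + t * \<tau>' z" for t z
      have \<sigma>C: "\<sigma> t \<in> C i" for t using \<tau>(1) \<tau>'(1) by (auto simp: C_def \<sigma>_def algebra_simps)
      have "(\<lambda>t. \<sigma> t z) = poly [:\<tau> z, \<tau>' z - \<tau> z:]" for z by (auto simp: \<sigma>_def algebra_simps)
      hence \<sigma>: "(\<lambda>t. \<sigma> t z) \<in> range poly" for z by (metis rangeI)
      have "(\<lambda>t. H (slice g n (\<sigma> t))) \<in> range poly" if "H \<in> image_functions g n" for H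
        by (rule image_functions_subst[OF that univariate.function_algebra_axioms slice_in_sym_tuples])
          (intro slice_matrix_function univariate.function_algebra_axioms \<sigma>)
      then obtain p q where pq: "(\<lambda>t. F (slice g n (\<sigma> t))) = poly p" "(\<lambda>t. G (slice g n (\<sigma> t))) = poly q"
        using F G by (meson imageE)
      have "\<sigma> 0 = \<tau>" "\<sigma> 1 = \<tau>'" by (auto simp: \<sigma>_def)
      hence "poly p 0 \<noteq> 0" "poly q 1 \<noteq> 0" using \<tau>(2) \<tau>'(2) by (auto simp flip: pq)
      hence "p * q \<noteq> 0" by auto
      moreover have "poly (p * q) t = 0" for t using FG \<sigma>C by (auto simp flip: pq)
      ultimately show False using poly_roots_finite[of "p * q"] infinite_alg_closed_field by auto
    qed
  next
    fix i assume i: "i < card (slice_index g n)"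
    have zi: "zs ! i \<in> slice_index g n" using i zs(1,2) nth_mem[of i zs] by simp
    have less: "y < zs ! i" if "y \<in> set (take i zs)" for y
    proof -
      from that obtain j where "j < i" "j < length zs" "y = zs ! j" by (auto simp: in_set_conv_nth)
      thus ?thesis using sorted_wrt_nth_less[OF zs(3), of j i] i zs(2) by simp
    qed
    have le: "y \<in> set (take (Suc i) zs)" if "y \<in> slice_index g n" "y \<le> zs ! i" for y
    proof -
      obtain j where j: "j < length zs" "y = zs ! j" using \<open>y \<in> slice_index g n\<close> zs(1) by (metis in_set_conv_nth)
      have "\<not> i < j" using sorted_wrt_nth_less[OF zs(3), of i j] j \<open>y \<le> zs ! i\<close> by auto
      thus ?thesis using j i zs(2) by (auto simp: in_set_conv_nth intro!: exI[of _ j])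
    qed
    from slice_separation[OF n \<alpha>(1) \<alpha>0 zi] obtain F \<tau>\<^sub>0 where F: "F \<in> image_functions g n"
      "\<And>\<tau>. (\<And>y. y \<in> slice_index g n \<Longrightarrow> y \<le> zs ! i \<Longrightarrow> \<tau> y = base_point \<alpha> y) \<Longrightarrow> F (slice g n \<tau>) = 0"
      "\<And>y. y < zs ! i \<Longrightarrow> \<tau>\<^sub>0 y = base_point \<alpha> y" "F (slice g n \<tau>\<^sub>0) \<noteq> 0" by blast
    show "\<exists>F\<in>image_functions g n. (\<forall>s\<in>slice g n ` C (Suc i). F s = 0) \<and> (\<exists>s\<in>slice g n ` C i. F s \<noteq> 0)"
    proof (intro bexI[OF _ F(1)] conjI ballI)
      show "F s = 0" if s: "s \<in> slice g n ` C (Suc i)" for s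
      proof -
        from s obtain \<tau> where \<tau>: "\<tau> \<in> C (Suc i)" "s = slice g n \<tau>" by blast
        show ?thesis unfolding \<tau>(2) by (rule F(2)) (use le \<tau>(1) in \<open>auto simp: C_def\<close>)
      qed
      have "\<tau>\<^sub>0 \<in> C i" using less F(3) by (auto simp: C_def)
      thus "\<exists>s\<in>slice g n ` C i. F s \<noteq> 0" using F(4) by blast
    qed
  qed
qed

theorem theorem27:
  fixes g n :: nat
  assumes "g \<ge> 1" and "n \<ge> 2"
  shows "krull_dim ((sym_invariants g n)\<lparr>carrier := pi_star g n `
            carrier (mat_invariants g n :: ((nat \<Rightarrow> 'k::alg_closed_field mat) \<Rightarrow> 'k) ring)\<rparr>)
         = enat ((n - 1) * (g * (g + 1) div 2) + g)"
proof -
  have n: "n \<ge> 1" using assms(2) by simp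
  show ?thesis
    unfolding image_ring_eq card_slice_index[symmetric]
    by (rule antisym[OF krull_dim_image_le[OF assms(1) n] krull_dim_image_ge[OF n]])
qed

end
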